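(* Let $p$ be a prime, let $k$ be a field with $\operatorname{char}(k)=p$ (not necessarily algebraically closed), and let $H$ be a finite-dimensional connected Hopf algebra over $k$. If $H$ is semisimple, then $H$ is commutative.
   Context: The coradical $H_0$ of a Hopf algebra $H$ over $k$ is the sum of all simple subcoalgebras of $H$; $H$ is connected if $H_0$ is one-dimensional. A Hopf algebra is semisimple (respectively commutative) if it is so as an algebra. *)

theory Defs
  imports Complex_Main "HOL-Library.Poly_Mapping" "HOL-Computational_Algebra.Primes"
begin

section \<open>Tensor powers of a vector space\<close>

text \<open>
  The type \<open>'a \<Rightarrow>\<^sub>0 'k\<close> is the free vector space on the set \<open>'a\<close>.  For a vector space \<open>V\<close>
  on the type \<open>'v\<close>, the tensor powers \<open>V \<otimes> V\<close> and \<open>V \<otimes> V \<otimes> V\<close> are the quotients of the free vector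
  spaces on \<open>'v \<times> 'v\<close> and \<open>'v \<times> 'v \<times> 'v\<close> by the subspaces of multilinear relations.  Since the
  scalar multiplication is a term and not part of the type, the quotient is not a type: tensors are
  handled through representatives in the free vector space, and equality of tensors is congruence
  modulo the relations.
\<close>

definition free_scale :: "'k::field \<Rightarrow> ('a \<Rightarrow>\<^sub>0 'k) \<Rightarrow> ('a \<Rightarrow>\<^sub>0 'k)" where
  "free_scale c p = Poly_Mapping.map ((*) c) p"

lemma lookup_free_scale [simp]:
  "Poly_Mapping.lookup (free_scale c p) x = c * Poly_Mapping.lookup p x"
  by (simp add: free_scale_def Poly_Mapping.map.rep_eq when_def)

lemma vector_space_free_scale: "vector_space free_scale"
  by unfold_locales (auto intro!: poly_mapping_eqI simp: lookup_add algebra_simps)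

abbreviation free_gen :: "'a \<Rightarrow> ('a \<Rightarrow>\<^sub>0 'k::field)" where
  "free_gen x \<equiv> Poly_Mapping.single x 1"

definition lin_ext :: "('k::field \<Rightarrow> 'v::ab_group_add \<Rightarrow> 'v) \<Rightarrow> ('a \<Rightarrow> 'v) \<Rightarrow> ('a \<Rightarrow>\<^sub>0 'k) \<Rightarrow> 'v" where
  "lin_ext s f p = (\<Sum>x\<in>Poly_Mapping.keys p. s (Poly_Mapping.lookup p x) (f x))"

abbreviation free_ext :: "('a \<Rightarrow> ('b \<Rightarrow>\<^sub>0 'k::field)) \<Rightarrow> ('a \<Rightarrow>\<^sub>0 'k) \<Rightarrow> ('b \<Rightarrow>\<^sub>0 'k)" where
  "free_ext \<equiv> lin_ext free_scale"

lemma linear_lin_ext: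
  fixes s :: "'k::field \<Rightarrow> 'v::ab_group_add \<Rightarrow> 'v" and f :: "'a \<Rightarrow> 'v"
  assumes "vector_space s"
  shows "Vector_Spaces.linear free_scale s (lin_ext s f)"
proof -
  interpret F: vector_space "free_scale :: 'k \<Rightarrow> ('a \<Rightarrow>\<^sub>0 'k) \<Rightarrow> _"
    by (rule vector_space_free_scale)
  interpret V: vector_space s by fact
  have ext: "lin_ext s f p = (\<Sum>x\<in>A. s (Poly_Mapping.lookup p x) (f x))"
    if "finite A" "Poly_Mapping.keys p \<subseteq> A" for p A
    unfolding lin_ext_def using that
    by (intro sum.mono_neutral_left) (auto simp: in_keys_iff)
  show ?thesis
  proof unfold_locales
    fix p q :: "'a \<Rightarrow>\<^sub>0 'k"
    let ?A = "Poly_Mapping.keys p \<union> Poly_Mapping.keys q"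
    have "Poly_Mapping.keys (p + q) \<subseteq> ?A"
      by (rule Poly_Mapping.keys_add)
    then show "lin_ext s f (p + q) = lin_ext s f p + lin_ext s f q"
      by (subst (1 2 3) ext[of ?A]) (auto simp: lookup_add V.scale_left_distrib sum.distrib)
  next
    fix c and p :: "'a \<Rightarrow>\<^sub>0 'k"
    have "Poly_Mapping.keys (free_scale c p) \<subseteq> Poly_Mapping.keys p"
      by (auto simp: in_keys_iff)
    then show "lin_ext s f (free_scale c p) = s c (lin_ext s f p)"
      by (subst (1 2) ext[of "Poly_Mapping.keys p"]) (auto simp: V.scale_sum_right)
  qed
qed

lemma lin_ext_free_gen [simp]: "vector_space s \<Longrightarrow> lin_ext s f (free_gen x) = f x"
  by (simp add: lin_ext_def vector_space_def)

definition tensor2_relations ::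
    "('k::field \<Rightarrow> 'v::ab_group_add \<Rightarrow> 'v) \<Rightarrow> (('v \<times> 'v) \<Rightarrow>\<^sub>0 'k) set" where
  "tensor2_relations s = module.span free_scale
    ({free_gen (x + x', y) - free_gen (x, y) - free_gen (x', y) | x x' y. True} \<union>
     {free_gen (x, y + y') - free_gen (x, y) - free_gen (x, y') | x y y'. True} \<union>
     {free_gen (s c x, y) - free_scale c (free_gen (x, y)) | c x y. True} \<union>
     {free_gen (x, s c y) - free_scale c (free_gen (x, y)) | c x y. True})"

definition tensor3_relations ::
    "('k::field \<Rightarrow> 'v::ab_group_add \<Rightarrow> 'v) \<Rightarrow> (('v \<times> 'v \<times> 'v) \<Rightarrow>\<^sub>0 'k) set" where
  "tensor3_relations s = module.span free_scale
    ({free_gen (x + x', y, z) - free_gen (x, y, z) - free_gen (x', y, z) | x x' y z. True} \<union>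
     {free_gen (x, y + y', z) - free_gen (x, y, z) - free_gen (x, y', z) | x y y' z. True} \<union>
     {free_gen (x, y, z + z') - free_gen (x, y, z) - free_gen (x, y, z') | x y z z'. True} \<union>
     {free_gen (s c x, y, z) - free_scale c (free_gen (x, y, z)) | c x y z. True} \<union>
     {free_gen (x, s c y, z) - free_scale c (free_gen (x, y, z)) | c x y z. True} \<union>
     {free_gen (x, y, s c z) - free_scale c (free_gen (x, y, z)) | c x y z. True})"

definition tensor2_eq ::
    "('k::field \<Rightarrow> 'v::ab_group_add \<Rightarrow> 'v) \<Rightarrow> (('v \<times> 'v) \<Rightarrow>\<^sub>0 'k) \<Rightarrow> (('v \<times> 'v) \<Rightarrow>\<^sub>0 'k) \<Rightarrow> bool" where
  "tensor2_eq s p q \<longleftrightarrow> p - q \<in> tensor2_relations s"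

definition tensor3_eq ::
    "('k::field \<Rightarrow> 'v::ab_group_add \<Rightarrow> 'v) \<Rightarrow> (('v \<times> 'v \<times> 'v) \<Rightarrow>\<^sub>0 'k) \<Rightarrow> (('v \<times> 'v \<times> 'v) \<Rightarrow>\<^sub>0 'k) \<Rightarrow> bool" where
  "tensor3_eq s p q \<longleftrightarrow> p - q \<in> tensor3_relations s"

text \<open>A multilinear map has a well-defined extension to the tensor power, also when it is multilinear
  only modulo a subspace \<open>W\<close> of its target.\<close>

lemma lin_ext_respects_tensor2:
  fixes s :: "'k::field \<Rightarrow> 'v::ab_group_add \<Rightarrow> 'v" and s' :: "'k \<Rightarrow> 'w::ab_group_add \<Rightarrow> 'w"
    and f :: "'v \<times> 'v \<Rightarrow> 'w"
  assumes "vector_space s'" and W: "module.subspace s' W"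
    and "\<And>x x' y. f (x + x', y) - f (x, y) - f (x', y) \<in> W"
    and "\<And>x y y'. f (x, y + y') - f (x, y) - f (x, y') \<in> W"
    and "\<And>c x y. f (s c x, y) - s' c (f (x, y)) \<in> W"
    and "\<And>c x y. f (x, s c y) - s' c (f (x, y)) \<in> W"
    and pq: "tensor2_eq s p q"
  shows "lin_ext s' f p - lin_ext s' f q \<in> W"
proof -
  interpret L: Vector_Spaces.linear free_scale s' "lin_ext s' f"
    by (rule linear_lin_ext) fact
  note gen = lin_ext_free_gen[OF assms(1)]
  have "lin_ext s' f t \<in> W" if "t \<in> tensor2_relations s" for t
    using that unfolding tensor2_relations_def
  proof (induction rule: L.vs1.span_induct)
    case (step t)
    then show ?case
      using assms(3-6) by (auto simp: L.diff L.scale gen)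
  next
    case base
    show ?case
      using L.subspace_vimage[OF W] by (simp add: vimage_def)
  qed
  from this[of "p - q"] pq show ?thesis
    by (simp add: tensor2_eq_def L.diff)
qed

text \<open>The product of \<open>A \<otimes> A\<close>, determined by \<open>(a \<otimes> b) (c \<otimes> d) = a c \<otimes> b d\<close>.\<close>

definition tensor2_mult ::
    "(('a::ring_1 \<times> 'a) \<Rightarrow>\<^sub>0 'k::field) \<Rightarrow> (('a \<times> 'a) \<Rightarrow>\<^sub>0 'k) \<Rightarrow> (('a \<times> 'a) \<Rightarrow>\<^sub>0 'k)" where
  "tensor2_mult p q =
     free_ext (\<lambda>(a, b). free_ext (\<lambda>(c, d). free_gen (a * c, b * d)) q) p"


section \<open>Algebras\<close>

locale algebra_over_field = vector_space scale
  for scale :: "'k::field \<Rightarrow> 'a::ring_1 \<Rightarrow> 'a" +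
  assumes scale_mult_left: "scale c x * y = scale c (x * y)"
    and scale_mult_right: "x * scale c y = scale c (x * y)"
begin

definition left_ideal :: "'a set \<Rightarrow> bool" where
  "left_ideal I \<longleftrightarrow> subspace I \<and> (\<forall>a. \<forall>x\<in>I. a * x \<in> I)"

definition simple_left_ideal :: "'a set \<Rightarrow> bool" where
  "simple_left_ideal I \<longleftrightarrow>
     left_ideal I \<and> I \<noteq> {0} \<and> (\<forall>J. left_ideal J \<and> J \<subseteq> I \<longrightarrow> J = {0} \<or> J = I)"

text \<open>The left regular module is a sum of simple submodules.\<close>

definition semisimple :: bool where
  "semisimple \<longleftrightarrow> span (\<Union>{I. simple_left_ideal I}) = UNIV"

end


section \<open>Coalgebras\<close>

text \<open>
  The comultiplication is given by a map \<open>\<Delta>\<close> choosing, for every \<open>x\<close>, a representative of the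
  tensor \<open>\<Delta> x\<close>; it is required to be linear as a map to the quotient only.
\<close>

locale coalgebra = vector_space scale
  for scale :: "'k::field \<Rightarrow> 'c::ab_group_add \<Rightarrow> 'c" +
  fixes \<Delta> :: "'c \<Rightarrow> (('c \<times> 'c) \<Rightarrow>\<^sub>0 'k)"
    and \<epsilon> :: "'c \<Rightarrow> 'k"
  assumes comult_add: "tensor2_eq scale (\<Delta> (x + y)) (\<Delta> x + \<Delta> y)"
    and comult_scale: "tensor2_eq scale (\<Delta> (scale c x)) (free_scale c (\<Delta> x))"
    and counit_linear: "Vector_Spaces.linear scale (*) \<epsilon>"
    and coassoc: "tensor3_eq scale
          (free_ext (\<lambda>(a, b). free_ext (\<lambda>(c, d). free_gen (c, d, b)) (\<Delta> a)) (\<Delta> x))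
          (free_ext (\<lambda>(a, b). free_ext (\<lambda>(c, d). free_gen (a, c, d)) (\<Delta> b)) (\<Delta> x))"
    and counit_left: "lin_ext scale (\<lambda>(a, b). scale (\<epsilon> a) b) (\<Delta> x) = x"
    and counit_right: "lin_ext scale (\<lambda>(a, b). scale (\<epsilon> b) a) (\<Delta> x) = x"
begin

text \<open>\<open>\<Delta> C \<subseteq> C \<otimes> C\<close>, where \<open>C \<otimes> C\<close> is viewed inside the tensor square of the whole coalgebra.\<close>

definition subcoalgebra :: "'c set \<Rightarrow> bool" where
  "subcoalgebra C \<longleftrightarrow> subspace C \<and>
     (\<forall>x\<in>C. \<exists>q. Poly_Mapping.keys q \<subseteq> C \<times> C \<and> tensor2_eq scale (\<Delta> x) q)"

definition simple_subcoalgebra :: "'c set \<Rightarrow> bool" where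
  "simple_subcoalgebra C \<longleftrightarrow>
     subcoalgebra C \<and> C \<noteq> {0} \<and> (\<forall>D. subcoalgebra D \<and> D \<subseteq> C \<longrightarrow> D = {0} \<or> D = C)"

definition coradical :: "'c set" where
  "coradical = span (\<Union>{C. simple_subcoalgebra C})"

definition connected :: bool where
  "connected \<longleftrightarrow> dim coradical = 1"

end


section \<open>Hopf algebras\<close>

locale bialgebra = algebra_over_field scale + coalgebra scale \<Delta> \<epsilon>
  for scale :: "'k::field \<Rightarrow> 'h::ring_1 \<Rightarrow> 'h"
    and \<Delta> :: "'h \<Rightarrow> (('h \<times> 'h) \<Rightarrow>\<^sub>0 'k)"
    and \<epsilon> :: "'h \<Rightarrow> 'k" +
  assumes comult_mult: "tensor2_eq scale (\<Delta> (x * y)) (tensor2_mult (\<Delta> x) (\<Delta> y))"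
    and comult_one: "tensor2_eq scale (\<Delta> 1) (free_gen (1, 1))"
    and counit_mult: "\<epsilon> (x * y) = \<epsilon> x * \<epsilon> y"
    and counit_one: "\<epsilon> 1 = 1"

locale hopf_algebra = bialgebra scale \<Delta> \<epsilon>
  for scale :: "'k::field \<Rightarrow> 'h::ring_1 \<Rightarrow> 'h"
    and \<Delta> :: "'h \<Rightarrow> (('h \<times> 'h) \<Rightarrow>\<^sub>0 'k)"
    and \<epsilon> :: "'h \<Rightarrow> 'k" +
  fixes S :: "'h \<Rightarrow> 'h"
  assumes antipode_linear: "Vector_Spaces.linear scale scale S"
    and antipode_left: "lin_ext scale (\<lambda>(a, b). S a * b) (\<Delta> x) = scale (\<epsilon> x) 1"
    and antipode_right: "lin_ext scale (\<lambda>(a, b). a * S b) (\<Delta> x) = scale (\<epsilon> x) 1"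

end

theory Submission
  imports "HOL-Algebra.Algebraic_Closure_Type" "HOL-Library.Function_Algebras" Defs
begin

text \<open>
  A semisimple \<open>H\<close> has a left integral \<open>\<Lambda>\<close> with \<open>\<epsilon> \<Lambda> = 1\<close>, and connectedness makes the augmentation ideal
  \<open>J\<close> of the dual algebra nilpotent.  A primitive element, also one with coefficients in an algebraically
  closed extension field, acts on the extended dual algebra by a derivation \<open>D\<close>.  The image of \<open>D\<close> does
  not contain the unit, because \<open>\<Lambda>\<close> kills it.  If \<open>D\<close> had a Jordan block, there would be \<open>F\<close> with
  \<open>D F = \<mu> F + G\<close> and \<open>D G = \<mu> G\<close>, where after a translation \<open>G\<close> does not vanish at \<open>1\<close>, so that it is
  invertible; but then \<open>D (G\<^sup>-\<^sup>1 F) = 1\<close>.  So all these derivations are diagonalizable, which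
  forces the primitive elements to commute with each other and then, along the coradical filtration, to
  be central.

  Finally let \<open>H\<^sub>n\<close> be the \<open>n\<close>-th term of the coradical filtration and suppose that it is commutative.  For
  \<open>x\<close> and \<open>y\<close> in \<open>H\<^bsub>n+1\<^esub>\<close> the commutator \<open>z\<close> is primitive (first for \<open>x\<close> in \<open>H\<^sub>n\<close>), hence central, and it equals
  the right adjoint action of \<open>x\<close> on \<open>y\<close>.  Acting with \<open>\<Lambda>\<close> gives \<open>z\<close> on the one hand and, since \<open>x \<Lambda> = 0\<close>,
  zero on the other.
\<close>

section \<open>Linear maps and tensors\<close>

text \<open>Eigenvalues of the operators involved need not lie in k. The k-linear maps from H to an
  extension field E are the E-dual of E \<otimes> H, so it suffices to enlarge the values of
  functionals: an element \<Sum> e_i \<otimes> x_i acts on them by sending F to the functional with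
  value \<Sum> e_i F(x_i a) at a. Nilpotency of J makes the dual algebra local, with F invertible as
  soon as F(1) is nonzero. A translation is F(x) \<mapsto> F(x a): it commutes with left
  multiplications and moves the value at a to 1. Diagonalizability is used in the form: if t is
  primitive and [t,[t,u]] = 0, then [t,u] = 0. Suppose [y,v] = \<mu> v with v primitive over E. Then
  [v,[v,y]] = 0, hence \<mu> v = -[v,y] = 0. So ad y has no nonzero eigenvalue on primitive elements
  and is nilpotent there, and the same principle for t = y makes it zero. The eigenvector v exists
  only over E, which is why derivations with coefficients in E are considered.\<close>

abbreviation linear where "linear \<equiv> Vector_Spaces.linear"

lemma linearI:
  assumes "vector_space s" "vector_space t" "\<And>x y. f (x + y) = f x + f y" "\<And>c x. f (s c x) = t c (f x)"
  shows "linear s t f"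
  using assms by (simp add: Vector_Spaces.linear_iff)

lemma linear_addD: "linear s t f \<Longrightarrow> f (x + y) = f x + f y"
  and linear_scaleD: "linear s t f \<Longrightarrow> f (s c x) = t c (f x)"
  and linear_source: "linear s t f \<Longrightarrow> vector_space s"
  and linear_target: "linear s t f \<Longrightarrow> vector_space t"
  by (simp_all add: Vector_Spaces.linear_iff)

lemma linear_zeroD: "linear s t f \<Longrightarrow> f 0 = 0"
  and linear_diffD: "linear s t f \<Longrightarrow> f (x - y) = f x - f y"
  and linear_sumD: "linear s t f \<Longrightarrow> f (\<Sum>i\<in>I. g i) = (\<Sum>i\<in>I. f (g i))"
  by (metis linear_iff_module_hom module_hom.zero)
     (metis linear_iff_module_hom module_hom.diff, metis linear_iff_module_hom module_hom.sum)

lemma linear_compose: "linear t u F \<Longrightarrow> linear s t f \<Longrightarrow> linear s u (\<lambda>x. F (f x))"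
  by (simp add: Vector_Spaces.linear_iff)

lemma linear_plus: "linear s t f \<Longrightarrow> linear s t g \<Longrightarrow> linear s t (\<lambda>x. f x + g x)"
  by (simp add: Vector_Spaces.linear_iff algebra_simps vector_space_def)

lemma linear_minus: "linear s t f \<Longrightarrow> linear s t g \<Longrightarrow> linear s t (\<lambda>x. f x - g x)"
  by (simp add: Vector_Spaces.linear_iff algebra_simps Modules.module.scale_right_diff_distrib module_iff_vector_space)

lemma linear_sum:
  assumes "vector_space s" "vector_space t" "\<And>i. i \<in> I \<Longrightarrow> linear s t (f i)"
  shows "linear s t (\<lambda>x. \<Sum>i\<in>I. f i x)"
proof -
  have "Modules.module t" using assms(2) by (simp add: module_iff_vector_space)
  with assms show ?thesis
    by (intro linearI) (simp_all add: linear_addD[OF assms(3)] linear_scaleD[OF assms(3)] sum.distrib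
      Modules.module.scale_sum_right cong: sum.cong)
qed

lemma linear_scale_const: "linear s t f \<Longrightarrow> linear s t (\<lambda>x. t c (f x))"
  by (simp add: Vector_Spaces.linear_iff algebra_simps vector_space_def)

definition bilinear ::
    "('k::field \<Rightarrow> 'v::ab_group_add \<Rightarrow> 'v) \<Rightarrow> ('k \<Rightarrow> 'w::ab_group_add \<Rightarrow> 'w) \<Rightarrow> ('v \<Rightarrow> 'v \<Rightarrow> 'w) \<Rightarrow> bool"
  where "bilinear s t \<beta> \<longleftrightarrow> (\<forall>y. linear s t (\<lambda>x. \<beta> x y)) \<and> (\<forall>x. linear s t (\<lambda>y. \<beta> x y))"

lemma bilinearI:
  "(\<And>y. linear s t (\<lambda>x. \<beta> x y)) \<Longrightarrow> (\<And>x. linear s t (\<lambda>y. \<beta> x y)) \<Longrightarrow> bilinear s t \<beta>"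
  by (simp add: bilinear_def)

lemma bilinearD:
  assumes "bilinear s t \<beta>"
  shows "linear s t (\<lambda>x. \<beta> x y)" "linear s t (\<lambda>y. \<beta> x y)"
  using assms by (simp_all add: bilinear_def)

lemma lin_ext_add: "vector_space t \<Longrightarrow> lin_ext t f (p + q) = lin_ext t f p + lin_ext t f q"
  and lin_ext_diff: "vector_space t \<Longrightarrow> lin_ext t f (p - q) = lin_ext t f p - lin_ext t f q"
  and lin_ext_scale: "vector_space t \<Longrightarrow> lin_ext t f (free_scale c p) = t c (lin_ext t f p)"
  by (rule linear_lin_ext[THEN linear_addD] linear_lin_ext[THEN linear_diffD]
      linear_lin_ext[THEN linear_scaleD], assumption)+

lemma lin_ext_fun_add:
  "vector_space t \<Longrightarrow> lin_ext t (\<lambda>x. f x + g x) p = lin_ext t f p + lin_ext t g p"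
  by (simp add: lin_ext_def vector_space_def sum.distrib)

lemma lin_ext_fun_zero: "vector_space t \<Longrightarrow> lin_ext t (\<lambda>x. 0) p = 0"
  by (simp add: lin_ext_def Modules.module.scale_zero_right module_iff_vector_space)

lemma linear_lin_ext_param:
  assumes "vector_space s" "vector_space t" "\<And>x. linear s t (\<lambda>v. f v x)"
  shows "linear s t (\<lambda>v. lin_ext t (f v) p)"
  unfolding lin_ext_def using assms by (intro linear_sum linear_scale_const) auto

lemma linear_lin_ext_comm:
  assumes "linear s t F"
  shows "F (lin_ext s f p) = lin_ext t (\<lambda>x. F (f x)) p"
  by (simp add: lin_ext_def linear_sumD[OF assms] linear_scaleD[OF assms])

lemma lin_ext_free_ext:
  "vector_space t \<Longrightarrow> lin_ext t f (free_ext g p) = lin_ext t (\<lambda>x. lin_ext t f (g x)) p"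
  by (rule linear_lin_ext_comm[OF linear_lin_ext])

lemma lin_ext_tensor2_eq:
  assumes "vector_space t" "bilinear s t \<beta>" "tensor2_eq s p q"
  shows "lin_ext t (\<lambda>(a, b). \<beta> a b) p = lin_ext t (\<lambda>(a, b). \<beta> a b) q"
proof -
  interpret T: vector_space t by fact
  note b = bilinearD[OF assms(2)]
  have "lin_ext t (\<lambda>(a, b). \<beta> a b) p - lin_ext t (\<lambda>(a, b). \<beta> a b) q \<in> {0}"
    by (rule lin_ext_respects_tensor2[OF assms(1) _ _ _ _ _ assms(3)])
       (simp_all add: T.subspace_single_0 b[THEN linear_addD] b[THEN linear_scaleD])
  then show ?thesis by simp
qed

lemma lin_ext_tensor3_eq:
  assumes t: "vector_space t"
    and "\<And>y z. linear s t (\<lambda>x. \<gamma> x y z)" "\<And>x z. linear s t (\<lambda>y. \<gamma> x y z)" "\<And>x y. linear s t (\<lambda>z. \<gamma> x y z)"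
    and pq: "tensor3_eq s p q"
  shows "lin_ext t (\<lambda>(a, b, c). \<gamma> a b c) p = lin_ext t (\<lambda>(a, b, c). \<gamma> a b c) q"
proof -
  note g = assms(2-4)
  let ?f = "\<lambda>(a, b, c). \<gamma> a b c"
  interpret L: Vector_Spaces.linear free_scale t "lin_ext t ?f"
    by (rule linear_lin_ext) fact
  have "lin_ext t ?f r = 0" if "r \<in> tensor3_relations s" for r
    using that unfolding tensor3_relations_def
  proof (induction rule: L.vs1.span_induct)
    case (step r)
    then show ?case
      by (auto simp: L.diff L.scale lin_ext_free_gen[OF t] g[THEN linear_addD] g[THEN linear_scaleD])
  next
    case base
    show ?case
      using L.subspace_vimage[OF L.vs2.subspace_single_0] by (simp add: vimage_def)
  qed
  from this[of "p - q"] pq show ?thesis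
    by (simp add: tensor3_eq_def L.diff)
qed

lemma tensor2_eq_refl [simp]: "tensor2_eq s p p"
  by (simp add: tensor2_eq_def tensor2_relations_def Modules.module.span_zero module_iff_vector_space vector_space_free_scale)

lemma subspace_tensor2_relations: "Modules.module.subspace free_scale (tensor2_relations s)"
  unfolding tensor2_relations_def
  by (simp add: Modules.module.subspace_span module_iff_vector_space vector_space_free_scale)

lemma vector_space_mult: "vector_space ((*) :: 'k::field \<Rightarrow> _)"
  by unfold_locales (auto simp: algebra_simps)

lemma algebra_mult: "algebra_over_field ((*) :: 'k::field \<Rightarrow> _)"
  by unfold_locales (auto simp: algebra_simps)

section \<open>Sweedler sums and convolution\<close>

named_theorems linear_intros

lemma linear_self [linear_intros]: "vector_space s \<Longrightarrow> linear s s (\<lambda>x. x)"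
  by (rule linearI) auto

lemma linear_const_zero [linear_intros]: "vector_space s \<Longrightarrow> vector_space t \<Longrightarrow> linear s t (\<lambda>x. 0)"
  by (rule linearI) (auto simp: Modules.module.scale_zero_right module_iff_vector_space)

declare linear_plus [linear_intros] linear_minus [linear_intros] linear_scale_const [linear_intros]

lemma linear_scale_fun [linear_intros]:
  assumes "vector_space t" "linear s (*) f"
  shows "linear s t (\<lambda>x. t (f x) c)"
proof (rule linearI)
  show "vector_space s" by (rule linear_source) fact
  show "t (f (x + y)) c = t (f x) c + t (f y) c" for x y
    using assms by (simp add: linear_addD vector_space_def)
  show "t (f (s a x)) c = t a (t (f x) c)" for a x
    using assms by (simp add: linear_scaleD vector_space_def)
qed fact

context algebra_over_field
begin

lemma linear_mult_left [linear_intros]: "linear s scale f \<Longrightarrow> linear s scale (\<lambda>x. f x * c)"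
  by (intro linearI) (auto simp: linear_addD linear_scaleD linear_source linear_target algebra_simps scale_mult_left)

lemma linear_mult_right [linear_intros]: "linear s scale f \<Longrightarrow> linear s scale (\<lambda>x. c * f x)"
  by (intro linearI) (auto simp: linear_addD linear_scaleD linear_source linear_target algebra_simps scale_mult_right)

lemma bilinear_mult:
  assumes "linear s scale F" "linear s scale G"
  shows "bilinear s scale (\<lambda>a b. F a * G b)"
  by (intro bilinearI linear_intros assms)

end

lemmas linear_mult_left' [linear_intros] = algebra_over_field.linear_mult_left
lemmas linear_mult_right' [linear_intros] = algebra_over_field.linear_mult_right

context coalgebra
begin

declare vector_space_axioms [simp, linear_intros]

text \<open>\<open>sw t \<beta> x\<close> is the Sweedler sum \<open>\<Sum> \<beta> x\<^sub>1 x\<^sub>2\<close>, with values in the space with scalar multiplication \<open>t\<close>.\<close>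

definition sw :: "('k \<Rightarrow> 'w::ab_group_add \<Rightarrow> 'w) \<Rightarrow> ('c \<Rightarrow> 'c \<Rightarrow> 'w) \<Rightarrow> 'c \<Rightarrow> 'w" where
  "sw t \<beta> x = lin_ext t (\<lambda>(a, b). \<beta> a b) (\<Delta> x)"

lemma sw_tensor2_eq:
  "vector_space t \<Longrightarrow> bilinear scale t \<beta> \<Longrightarrow> tensor2_eq scale (\<Delta> x) q
    \<Longrightarrow> sw t \<beta> x = lin_ext t (\<lambda>(a, b). \<beta> a b) q"
  unfolding sw_def by (rule lin_ext_tensor2_eq)

lemma linear_sw:
  assumes t: "vector_space t" and b: "bilinear scale t \<beta>"
  shows "linear scale t (sw t \<beta>)"
proof (rule linearI)
  fix x y c
  show "sw t \<beta> (x + y) = sw t \<beta> x + sw t \<beta> y"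
    by (subst sw_tensor2_eq[OF t b comult_add]) (simp add: lin_ext_add t sw_def)
  show "sw t \<beta> (scale c x) = t c (sw t \<beta> x)"
    by (subst sw_tensor2_eq[OF t b comult_scale]) (simp add: lin_ext_scale t sw_def)
qed (use t in auto)

lemma linear_sw' [linear_intros]:
  "vector_space t \<Longrightarrow> bilinear scale t \<beta> \<Longrightarrow> linear s scale f \<Longrightarrow> linear s t (\<lambda>x. sw t \<beta> (f x))"
  by (rule linear_compose[OF linear_sw])

lemma linear_sw_param [linear_intros]:
  assumes "vector_space s" "vector_space t" "\<And>a b. linear s t (\<lambda>v. \<beta> v a b)"
  shows "linear s t (\<lambda>v. sw t (\<beta> v) x)"
  unfolding sw_def using assms by (intro linear_lin_ext_param) auto

lemma sw_add_fun: "vector_space t \<Longrightarrow> sw t (\<lambda>a b. \<beta> a b + \<gamma> a b) x = sw t \<beta> x + sw t \<gamma> x"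
  unfolding sw_def by (simp add: lin_ext_fun_add[symmetric] case_prod_unfold)

lemma sw_linear_comm: "linear s t F \<Longrightarrow> F (sw s \<beta> x) = sw t (\<lambda>a b. F (\<beta> a b)) x"
  unfolding sw_def by (simp add: linear_lin_ext_comm case_prod_unfold)

lemma sw_scale_fun:
  assumes "vector_space t"
  shows "t c (sw t \<beta> x) = sw t (\<lambda>a b. t c (\<beta> a b)) x"
  by (rule sw_linear_comm[OF linear_scale_const[OF linear_self[OF assms]]])

lemma sw_swap:
  assumes "vector_space t"
  shows "sw t (\<lambda>a b. sw t (\<lambda>c d. f a b c d) y) x = sw t (\<lambda>c d. sw t (\<lambda>a b. f a b c d) x) y"
proof -
  interpret T: vector_space t by fact
  show ?thesis
    unfolding sw_def lin_ext_def case_prod_unfold T.scale_sum_right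
    by (subst sum.swap) (simp add: mult.commute)
qed

lemma sw_coassoc:
  assumes t: "vector_space t"
    and "\<And>y z. linear scale t (\<lambda>x. \<gamma> x y z)" "\<And>x z. linear scale t (\<lambda>y. \<gamma> x y z)"
      "\<And>x y. linear scale t (\<lambda>z. \<gamma> x y z)"
  shows "sw t (\<lambda>a b. sw t (\<lambda>c d. \<gamma> c d b) a) x = sw t (\<lambda>a b. sw t (\<lambda>c d. \<gamma> a c d) b) x"
  using lin_ext_tensor3_eq[where \<gamma> = \<gamma>, OF assms coassoc]
  by (simp add: lin_ext_free_ext t case_prod_unfold sw_def)

lemma linear_counit [linear_intros]: "linear s scale f \<Longrightarrow> linear s (*) (\<lambda>x. \<epsilon> (f x))"
  by (rule linear_compose[OF counit_linear])

lemma sw_counit_left: "linear scale t F \<Longrightarrow> sw t (\<lambda>a b. t (\<epsilon> a) (F b)) x = F x"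
  by (subst (2) counit_left[symmetric, of x])
     (simp add: linear_lin_ext_comm sw_def case_prod_unfold linear_scaleD)

lemma sw_counit_right: "linear scale t F \<Longrightarrow> sw t (\<lambda>a b. t (\<epsilon> b) (F a)) x = F x"
  by (subst (2) counit_right[symmetric, of x])
     (simp add: linear_lin_ext_comm sw_def case_prod_unfold linear_scaleD)

text \<open>The target algebra is a parameter, so that one definition yields the product of the dual
  algebra and the product of functionals with values in an extension field.\<close>

definition conv :: "('k \<Rightarrow> 'w::ring_1 \<Rightarrow> 'w) \<Rightarrow> ('c \<Rightarrow> 'w) \<Rightarrow> ('c \<Rightarrow> 'w) \<Rightarrow> 'c \<Rightarrow> 'w" where
  "conv t F G = sw t (\<lambda>a b. F a * G b)"

lemma linear_conv:
  assumes "algebra_over_field t" "linear scale t F" "linear scale t G"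
  shows "linear scale t (conv t F G)"
  unfolding conv_def
  by (intro linear_sw algebra_over_field.bilinear_mult assms algebra_over_field.axioms(1)[OF assms(1)])

lemma conv_assoc:
  assumes t: "algebra_over_field t" and F: "linear scale t F" and G: "linear scale t G" and H: "linear scale t H"
  shows "conv t (conv t F G) H = conv t F (conv t G H)"
proof
  fix x
  interpret T: algebra_over_field t by fact
  note tv = T.vector_space_axioms
  have "conv t (conv t F G) H x = sw t (\<lambda>a b. sw t (\<lambda>c d. F c * G d * H b) a) x"
    unfolding conv_def by (subst sw_linear_comm[OF T.linear_mult_left[OF linear_self[OF tv]]]) simp
  also have "\<dots> = sw t (\<lambda>a b. sw t (\<lambda>c d. F a * G c * H d) b) x"
    by (rule sw_coassoc[OF tv]) (intro linear_intros F G H t)+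
  also have "\<dots> = conv t F (conv t G H) x"
    unfolding conv_def by (subst sw_linear_comm[OF T.linear_mult_right[OF linear_self[OF tv]]]) (simp add: mult.assoc)
  finally show "conv t (conv t F G) H x = conv t F (conv t G H) x" .
qed

lemma linear_unit: "algebra_over_field t \<Longrightarrow> linear scale t (\<lambda>x. t (\<epsilon> x) 1)"
  by (intro linear_intros vector_space_axioms algebra_over_field.axioms(1))

lemma conv_unit_left:
  assumes t: "algebra_over_field t" and F: "linear scale t F"
  shows "conv t (\<lambda>x. t (\<epsilon> x) 1) F = F"
  using sw_counit_left[OF F] by (simp add: fun_eq_iff conv_def algebra_over_field.scale_mult_left[OF t])

lemma conv_unit_right:
  assumes t: "algebra_over_field t" and F: "linear scale t F"
  shows "conv t F (\<lambda>x. t (\<epsilon> x) 1) = F"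
  using sw_counit_right[OF F] by (simp add: fun_eq_iff conv_def algebra_over_field.scale_mult_right[OF t])

text \<open>The actions \<open>F \<rightharpoonup> x = \<Sum> F(x\<^sub>2) x\<^sub>1\<close> and \<open>x \<leftharpoonup> F = \<Sum> F(x\<^sub>1) x\<^sub>2\<close> of the dual algebra.\<close>

definition lhit :: "('c \<Rightarrow> 'k) \<Rightarrow> 'c \<Rightarrow> 'c" where
  "lhit F = sw scale (\<lambda>a b. scale (F b) a)"

definition rhit :: "'c \<Rightarrow> ('c \<Rightarrow> 'k) \<Rightarrow> 'c" where
  "rhit x F = sw scale (\<lambda>a b. scale (F a) b) x"

abbreviation functional :: "('c \<Rightarrow> 'k) \<Rightarrow> bool" where
  "functional \<equiv> linear scale (*)"

abbreviation convk where "convk \<equiv> conv (*)"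

lemma functional_conv: "functional F \<Longrightarrow> functional G \<Longrightarrow> functional (convk F G)"
  by (rule linear_conv[OF algebra_mult])

lemma linear_lhit: "functional F \<Longrightarrow> linear scale scale (lhit F)"
  unfolding lhit_def by (intro linear_sw bilinearI linear_intros) auto

lemma linear_rhit: "functional F \<Longrightarrow> linear scale scale (\<lambda>x. rhit x F)"
  unfolding rhit_def by (intro linear_sw bilinearI linear_intros) auto

lemma functional_lhit: "functional F \<Longrightarrow> functional G \<Longrightarrow> G (lhit F x) = convk G F x"
  unfolding lhit_def conv_def
  by (subst sw_linear_comm) (auto simp: linear_scaleD mult.commute)

lemma functional_rhit: "functional F \<Longrightarrow> functional G \<Longrightarrow> G (rhit x F) = convk F G x"
  unfolding rhit_def conv_def
  by (subst sw_linear_comm) (auto simp: linear_scaleD mult.commute)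

lemma counit_lhit: "functional F \<Longrightarrow> \<epsilon> (lhit F x) = F x"
  using conv_unit_left[OF algebra_mult, of F] by (simp add: functional_lhit counit_linear)

lemma counit_rhit: "functional F \<Longrightarrow> \<epsilon> (rhit x F) = F x"
  using conv_unit_right[OF algebra_mult, of F] by (simp add: functional_rhit counit_linear)

lemma lhit_counit: "lhit \<epsilon> x = x"
  using counit_right unfolding lhit_def sw_def .

lemma rhit_counit: "rhit x \<epsilon> = x"
  using counit_left unfolding rhit_def sw_def .

lemma lhit_lhit:
  assumes F: "functional F" and G: "functional G"
  shows "lhit F (lhit G x) = lhit (convk F G) x"
proof -
  have "lhit F (lhit G x) = sw scale (\<lambda>a b. scale (G b) (lhit F a)) x"
    unfolding lhit_def[of G] by (subst sw_linear_comm[OF linear_lhit[OF F]]) (simp add: linear_scaleD[OF linear_lhit[OF F]])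
  also have "\<dots> = sw scale (\<lambda>a b. sw scale (\<lambda>c d. scale (F d * G b) c) a) x"
    unfolding lhit_def by (simp add: sw_scale_fun mult.commute)
  also have "\<dots> = sw scale (\<lambda>a b. sw scale (\<lambda>c d. scale (F c * G d) a) b) x"
    by (rule sw_coassoc[OF vector_space_axioms]) (intro linear_intros F G vector_space_axioms algebra_mult)+
  also have "\<dots> = sw scale (\<lambda>a b. scale (convk F G b) a) x"
    unfolding conv_def by (subst sw_linear_comm[where t = scale and F = "\<lambda>c. scale c _", OF linear_scale_fun[OF vector_space_axioms linear_self[OF vector_space_mult]]]) simp
  finally show ?thesis by (simp add: lhit_def)
qed

lemma rhit_rhit:
  assumes F: "functional F" and G: "functional G"
  shows "rhit (rhit x F) G = rhit x (convk F G)"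
proof -
  have "rhit (rhit x F) G = sw scale (\<lambda>a b. scale (F a) (rhit b G)) x"
    unfolding rhit_def[of x F] by (subst sw_linear_comm[OF linear_rhit[OF G]]) (simp add: linear_scaleD[OF linear_rhit[OF G]])
  also have "\<dots> = sw scale (\<lambda>a b. sw scale (\<lambda>c d. scale (F a * G c) d) b) x"
    by (simp add: rhit_def sw_scale_fun mult.commute)
  also have "\<dots> = sw scale (\<lambda>a b. sw scale (\<lambda>c d. scale (F c * G d) b) a) x"
    by (rule sw_coassoc[OF vector_space_axioms, symmetric]) (intro linear_intros F G vector_space_axioms algebra_mult)+
  also have "\<dots> = sw scale (\<lambda>a b. scale (convk F G a) b) x"
    unfolding conv_def by (subst sw_linear_comm[where t = scale and F = "\<lambda>c. scale c _", OF linear_scale_fun[OF vector_space_axioms linear_self[OF vector_space_mult]]]) simp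
  finally show ?thesis by (simp add: rhit_def)
qed

text \<open>By coassociativity both sides apply G to the first and F to the third factor of the
  iterated comultiplication. So H is a bimodule over its dual algebra.\<close>

lemma lhit_rhit:
  assumes F: "functional F" and G: "functional G"
  shows "lhit F (rhit x G) = rhit (lhit F x) G"
proof -
  have "lhit F (rhit x G) = sw scale (\<lambda>a b. scale (G a) (lhit F b)) x"
    unfolding rhit_def by (subst sw_linear_comm[OF linear_lhit[OF F]]) (simp add: linear_scaleD[OF linear_lhit[OF F]])
  also have "\<dots> = sw scale (\<lambda>a b. sw scale (\<lambda>c d. scale (G a * F d) c) b) x"
    unfolding lhit_def by (simp add: sw_scale_fun mult.commute)
  also have "\<dots> = sw scale (\<lambda>a b. sw scale (\<lambda>c d. scale (G c * F b) d) a) x"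
    by (rule sw_coassoc[OF vector_space_axioms, symmetric]) (intro linear_intros F G vector_space_axioms algebra_mult)+
  also have "\<dots> = sw scale (\<lambda>a b. scale (F b) (rhit a G)) x"
    by (simp add: rhit_def sw_scale_fun mult.commute)
  also have "\<dots> = rhit (lhit F x) G"
    unfolding lhit_def[of F] by (subst sw_linear_comm[OF linear_rhit[OF G]]) (simp add: linear_scaleD[OF linear_rhit[OF G]])
  finally show ?thesis .
qed

end

context bialgebra
begin

lemma sw_one:
  assumes "vector_space t" "bilinear scale t \<beta>"
  shows "sw t \<beta> 1 = \<beta> 1 1"
  using sw_tensor2_eq[OF assms comult_one] assms(1) by simp

lemma sw_mult:
  assumes t: "vector_space t" and b: "bilinear scale t \<beta>"
  shows "sw t \<beta> (x * y) = sw t (\<lambda>a b. sw t (\<lambda>c d. \<beta> (a * c) (b * d)) y) x"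
  using sw_tensor2_eq[OF t b comult_mult]
  by (simp add: tensor2_mult_def lin_ext_free_ext t case_prod_unfold sw_def)

lemma lhit_one: "functional F \<Longrightarrow> lhit F 1 = scale (F 1) 1"
  unfolding lhit_def by (subst sw_one) (auto intro!: bilinearI linear_intros)

lemma rhit_one: "functional F \<Longrightarrow> rhit 1 F = scale (F 1) 1"
  unfolding rhit_def by (subst sw_one) (auto intro!: bilinearI linear_intros)

end

context hopf_algebra
begin

lemma linear_antipode [linear_intros]: "linear s scale f \<Longrightarrow> linear s scale (\<lambda>x. S (f x))"
  by (rule linear_compose[OF antipode_linear])

lemma sw_antipode_left: "sw scale (\<lambda>a b. S a * b) x = scale (\<epsilon> x) 1"
  and sw_antipode_right: "sw scale (\<lambda>a b. a * S b) x = scale (\<epsilon> x) 1"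
  by (simp_all add: sw_def antipode_left antipode_right)

declare algebra_over_field_axioms [simp]

text \<open>Takes the place of the antimultiplicativity of the antipode.\<close>

lemma sw_antipode_mult:
  "sw scale (\<lambda>b c. S (b * a) * c) x = scale (\<epsilon> x) (S a)"
proof -
  \<comment> \<open>The middle of the chain is \<Sum> \<open>S (x\<^sub>1 * a\<^sub>1) * x\<^sub>2 *
    a\<^sub>2 * S a\<^sub>3\<close>. Collapsing
    \<open>S (x\<^sub>1 * a\<^sub>1) * (x\<^sub>2 * a\<^sub>2)\<close> leads to one side, collapsing
    \<open>a\<^sub>2 * S a\<^sub>3\<close> to the other.\<close>
  have "scale (\<epsilon> x) (S a) = sw scale (\<lambda>c d. scale (\<epsilon> c) (scale (\<epsilon> x) (S d))) a"
    by (rule sw_counit_left[symmetric]) (intro linear_intros vector_space_axioms)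
  also have "\<dots> = sw scale (\<lambda>c d. scale (\<epsilon> (x * c)) 1 * S d) a"
    by (simp add: counit_mult scale_mult_left mult.commute)
  also have "\<dots> = sw scale (\<lambda>c d. sw scale (\<lambda>u v. S u * v) (x * c) * S d) a"
    by (simp add: sw_antipode_left)
  also have "\<dots> = sw scale (\<lambda>c d. sw scale (\<lambda>u v. sw scale (\<lambda>e f. S (u * e) * (v * f)) c) x * S d) a"
    by (subst sw_mult) (auto intro!: bilinearI linear_intros)
  also have "\<dots> = sw scale (\<lambda>c d. sw scale (\<lambda>u v. sw scale (\<lambda>e f. S (u * e) * (v * f) * S d) c) x) a"
    by (simp add: sw_linear_comm[OF linear_mult_left[OF linear_self[OF vector_space_axioms]]])
  also have "\<dots> = sw scale (\<lambda>u v. sw scale (\<lambda>c d. sw scale (\<lambda>e f. S (u * e) * (v * f) * S d) c) a) x"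
    by (rule sw_swap[OF vector_space_axioms])
  also have "\<dots> = sw scale (\<lambda>u v. sw scale (\<lambda>c d. sw scale (\<lambda>e f. S (u * c) * (v * e) * S f) d) a) x"
    by (subst sw_coassoc) (auto intro!: linear_intros)
  also have "\<dots> = sw scale (\<lambda>u v. sw scale (\<lambda>c d. S (u * c) * v * sw scale (\<lambda>e f. e * S f) d) a) x"
    by (simp add: sw_linear_comm[OF linear_mult_right[OF linear_self[OF vector_space_axioms]]] mult.assoc)
  also have "\<dots> = sw scale (\<lambda>u v. sw scale (\<lambda>c d. scale (\<epsilon> d) (S (u * c) * v)) a) x"
    by (simp add: sw_antipode_right scale_mult_right)
  also have "\<dots> = sw scale (\<lambda>u v. S (u * a) * v) x"
    by (subst sw_counit_right) (auto intro!: linear_intros)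
  finally show ?thesis by simp
qed

end

section \<open>Tensors with components in a subspace\<close>

lemma free_gen_expansion: "p = (\<Sum>k\<in>Poly_Mapping.keys p. free_scale (Poly_Mapping.lookup p k) (free_gen k))"
proof (rule poly_mapping_eqI)
  fix k
  have "(\<Sum>i\<in>Poly_Mapping.keys p. Poly_Mapping.lookup p i * (1 when i = k)) =
      (\<Sum>i\<in>Poly_Mapping.keys p. if i = k then Poly_Mapping.lookup p k else 0)"
    by (rule sum.cong) auto
  also have "\<dots> = Poly_Mapping.lookup p k"
    by (simp add: in_keys_iff)
  finally show "Poly_Mapping.lookup p k =
      Poly_Mapping.lookup (\<Sum>k\<in>Poly_Mapping.keys p. free_scale (Poly_Mapping.lookup p k) (free_gen k)) k"
    by (simp add: lookup_sum lookup_single)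
qed

lemma tensor2_eq_add:
  assumes "tensor2_eq s p q" "tensor2_eq s p' q'"
  shows "tensor2_eq s (p + p') (q + q')"
proof -
  interpret F: vector_space free_scale by (rule vector_space_free_scale)
  have "(p + p') - (q + q') = (p - q) + (p' - q')" by simp
  then show ?thesis
    using F.subspace_add[OF subspace_tensor2_relations assms[unfolded tensor2_eq_def]]
    by (simp add: tensor2_eq_def algebra_simps)
qed

lemma tensor2_eq_sum:
  "(\<And>i. i \<in> I \<Longrightarrow> tensor2_eq s (P i) (Q i)) \<Longrightarrow> tensor2_eq s (\<Sum>i\<in>I. P i) (\<Sum>i\<in>I. Q i)"
  by (induction I rule: infinite_finite_induct) (auto intro: tensor2_eq_add)

lemma tensor2_eq_scale:
  assumes "tensor2_eq s p q"
  shows "tensor2_eq s (free_scale c p) (free_scale c q)"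
proof -
  interpret F: vector_space free_scale by (rule vector_space_free_scale)
  show ?thesis
    using F.subspace_scale[OF subspace_tensor2_relations assms[unfolded tensor2_eq_def], of c]
    by (simp add: tensor2_eq_def F.scale_right_diff_distrib)
qed

lemma tensor2_eq_trans: 
  assumes "tensor2_eq s p q" "tensor2_eq s q r"
  shows "tensor2_eq s p r"
proof -
  interpret F: vector_space free_scale by (rule vector_space_free_scale)
  have "p - r = (p - q) + (q - r)" by simp
  then show ?thesis
    using F.subspace_add[OF subspace_tensor2_relations assms[unfolded tensor2_eq_def]]
    by (simp add: tensor2_eq_def)
qed

context vector_space
begin

lemma
  shows tensor2_gen_add_left: "tensor2_eq scale (free_gen (x + x', y)) (free_gen (x, y) + free_gen (x', y))"
    and tensor2_gen_add_right: "tensor2_eq scale (free_gen (x, y + y')) (free_gen (x, y) + free_gen (x, y'))"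
    and tensor2_gen_scale_left: "tensor2_eq scale (free_gen (scale c x, y)) (free_scale c (free_gen (x, y)))"
    and tensor2_gen_scale_right: "tensor2_eq scale (free_gen (x, scale c y)) (free_scale c (free_gen (x, y)))"
proof -
  interpret F: vector_space "free_scale :: 'a \<Rightarrow> (('b \<times> 'b) \<Rightarrow>\<^sub>0 'a) \<Rightarrow> _" by (rule vector_space_free_scale)
  show "tensor2_eq scale (free_gen (x + x', y)) (free_gen (x, y) + free_gen (x', y))"
    "tensor2_eq scale (free_gen (x, y + y')) (free_gen (x, y) + free_gen (x, y'))"
    "tensor2_eq scale (free_gen (scale c x, y)) (free_scale c (free_gen (x, y)))"
    "tensor2_eq scale (free_gen (x, scale c y)) (free_scale c (free_gen (x, y)))"
    unfolding tensor2_eq_def tensor2_relations_def diff_diff_eq[symmetric]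
    by (rule F.span_base; blast)+
qed

lemma tensor2_gen_zero: "tensor2_eq scale (free_gen (0, y)) 0" "tensor2_eq scale (free_gen (x, 0)) 0"
proof -
  have [simp]: "free_scale 0 p = (0 :: ('b \<times> 'b) \<Rightarrow>\<^sub>0 'a)" for p
    by (rule poly_mapping_eqI) simp
  show "tensor2_eq scale (free_gen (0, y)) 0" "tensor2_eq scale (free_gen (x, 0)) 0"
    using tensor2_gen_scale_left[of 0 0 y] tensor2_gen_scale_right[of x 0 0] by simp_all
qed

lemma tensor2_gen_sum_left:
  "tensor2_eq scale (free_gen (\<Sum>i\<in>I. scale (a i) (f i), y)) (\<Sum>i\<in>I. free_scale (a i) (free_gen (f i, y)))"
proof (induction I rule: infinite_finite_induct)
  case (insert i I)
  then show ?case
    by (auto intro!: tensor2_eq_trans[OF tensor2_gen_add_left] tensor2_eq_add tensor2_gen_scale_left)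
qed (auto simp: tensor2_gen_zero)

lemma tensor2_gen_sum_right:
  "tensor2_eq scale (free_gen (x, \<Sum>i\<in>I. scale (a i) (f i))) (\<Sum>i\<in>I. free_scale (a i) (free_gen (x, f i)))"
proof (induction I rule: infinite_finite_induct)
  case (insert i I)
  then show ?case
    by (auto intro!: tensor2_eq_trans[OF tensor2_gen_add_right] tensor2_eq_add tensor2_gen_scale_right)
qed (auto simp: tensor2_gen_zero)

lemma functional_separating:
  assumes "subspace U" "x \<notin> U"
  obtains F where "linear scale (*) F" "\<And>y. y \<in> U \<Longrightarrow> F y = 0" "F x = 1"
proof -
  interpret K: vector_space "(*) :: 'a \<Rightarrow> _" by (rule vector_space_mult)
  interpret P: vector_space_pair scale "(*)" ..
  obtain B where B: "B \<subseteq> U" "independent B" "U \<subseteq> span B"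
    using basis_exists by metis
  have "span B \<subseteq> U" using B(1) assms(1) by (rule span_minimal)
  with assms have x: "x \<notin> span B" by auto
  with B have "independent (insert x B)" by (intro independent_insertI)
  then obtain F where F: "linear scale (*) F" "\<forall>b\<in>insert x B. F b = (if b = x then 1 else 0)"
    using P.linear_independent_extend[where f = "\<lambda>b. if b = x then 1 else 0"] by blast
  have "F y = 0" if "y \<in> U" for y
  proof -
    from F(1) interpret L: Vector_Spaces.linear scale "(*)" F .
    have "x \<notin> B" using x span_base by blast
    then have "F b = 0" if "b \<in> B" for b using F(2) that by auto
    with B(3) that show ?thesis using L.eq_0_on_span by blast
  qed
  with F that show ?thesis by auto
qed

lemma functional_eqI:
  assumes "\<And>F. linear scale (*) F \<Longrightarrow> F x = F y"
  shows "x = y"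
proof (rule ccontr)
  assume "x \<noteq> y"
  then obtain F where F: "linear scale (*) F" "F (x - y) = 1"
    using functional_separating[OF subspace_single_0, of "x - y"] by auto
  then show False using assms[OF F(1)] by (simp add: linear_diffD[OF F(1)])
qed

end

context finite_dimensional_vector_space
begin

text \<open>Extend a basis of \<open>C\<close> to a basis of the whole space. The coordinates of
  \<open>p\<close> on tensors of basis vectors are coordinates of the slices in \<open>left\<close>
  and \<open>right\<close>, so every coordinate with a component outside the basis of
  \<open>C\<close> vanishes.\<close>

lemma tensor2_in_subspace:
  assumes C: "subspace C"
    and left: "\<And>F. linear scale (*) F \<Longrightarrow> lin_ext scale (\<lambda>(a, b). scale (F b) a) p \<in> C"
    and right: "\<And>F. linear scale (*) F \<Longrightarrow> lin_ext scale (\<lambda>(a, b). scale (F a) b) p \<in> C"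
  obtains q where "Poly_Mapping.keys q \<subseteq> C \<times> C" "tensor2_eq scale p q"
proof -
  interpret F: vector_space "free_scale :: 'a \<Rightarrow> (('b \<times> 'b) \<Rightarrow>\<^sub>0 'a) \<Rightarrow> _" by (rule vector_space_free_scale)
  obtain B0 where B0: "B0 \<subseteq> C" "independent B0" "C \<subseteq> span B0"
    using basis_exists by metis
  obtain B where B: "B0 \<subseteq> B" "independent B" "UNIV \<subseteq> span B"
    using maximal_independent_subset_extend[OF subset_UNIV B0(2)] by metis
  have fin: "finite B" using B(2) by (rule finiteI_independent)
  let ?r = "representation B"
  have lin: "linear scale (*) (\<lambda>x. ?r x b)" for b
    using B by (intro linear_representation) auto
  have rC: "?r x b = 0" if "x \<in> C" "b \<notin> B0" for x b
  proof -
    have "x \<in> span B0" using that B0 by auto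
    then have "?r x = representation B0 x" using B by (intro representation_extend) auto
    then show ?thesis using representation_ne_zero that(2) by metis
  qed
  \<comment> \<open>The expansion of \<open>p\<close> in tensors of basis vectors. It is linear in
    \<open>p\<close>, so its equivalence with \<open>p\<close> has to be checked on generators
    only.\<close>
  define \<Phi> where "\<Phi> p = (\<Sum>c\<in>B. \<Sum>b\<in>B.
    free_scale (lin_ext (*) (\<lambda>(x, y). ?r x c * ?r y b) p) (free_gen (c, b)))" for p
  have \<Phi>_linear: "linear free_scale free_scale \<Phi>"
    unfolding \<Phi>_def
    by (intro linear_sum linear_scale_fun linear_lin_ext vector_space_mult vector_space_free_scale)
  have gen: "tensor2_eq scale (free_gen (x, y)) (\<Phi> (free_gen (x, y)))" for x y
  proof -
    have x: "(\<Sum>c\<in>B. scale (?r x c) c) = x" and y: "(\<Sum>c\<in>B. scale (?r y c) c) = y"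
      using B fin by (auto intro!: sum_representation_eq)
    have 1: "tensor2_eq scale (free_gen (x, y)) (\<Sum>c\<in>B. free_scale (?r x c) (free_gen (c, y)))"
      using tensor2_gen_sum_left[where I = B and a = "?r x" and f = "\<lambda>c. c"] unfolding x .
    have 2: "tensor2_eq scale (free_gen (c, y)) (\<Sum>b\<in>B. free_scale (?r y b) (free_gen (c, b)))" for c
      using tensor2_gen_sum_right[where I = B and a = "?r y" and f = "\<lambda>c. c"] unfolding y .
    have "tensor2_eq scale (free_gen (x, y))
        (\<Sum>c\<in>B. free_scale (?r x c) (\<Sum>b\<in>B. free_scale (?r y b) (free_gen (c, b))))"
      by (rule tensor2_eq_trans[OF 1]) (intro tensor2_eq_sum tensor2_eq_scale 2)
    also have "(\<Sum>c\<in>B. free_scale (?r x c) (\<Sum>b\<in>B. free_scale (?r y b) (free_gen (c, b)))) = \<Phi> (free_gen (x, y))"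
      by (simp add: \<Phi>_def F.scale_sum_right vector_space_mult)
    finally show ?thesis .
  qed
  have "tensor2_eq scale p (\<Phi> p)"
  proof -
    have "\<Phi> p = \<Phi> (\<Sum>k\<in>Poly_Mapping.keys p. free_scale (Poly_Mapping.lookup p k) (free_gen k))"
      using free_gen_expansion[of p] by (rule arg_cong)
    also have "\<dots> = (\<Sum>k\<in>Poly_Mapping.keys p. free_scale (Poly_Mapping.lookup p k) (\<Phi> (free_gen k)))"
      by (simp only: linear_sumD[OF \<Phi>_linear] linear_scaleD[OF \<Phi>_linear])
    finally have \<Phi>: "\<Phi> p = \<dots>" .
    have "tensor2_eq scale (\<Sum>k\<in>Poly_Mapping.keys p. free_scale (Poly_Mapping.lookup p k) (free_gen k))
      (\<Sum>k\<in>Poly_Mapping.keys p. free_scale (Poly_Mapping.lookup p k) (\<Phi> (free_gen k)))"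
      using gen by (intro tensor2_eq_sum tensor2_eq_scale) auto
    then show ?thesis unfolding \<Phi> free_gen_expansion[symmetric] .
  qed
  moreover have "Poly_Mapping.keys (\<Phi> p) \<subseteq> C \<times> C"
  proof -
    have z: "lin_ext (*) (\<lambda>(x, y). ?r x c * ?r y b) p = 0" if "\<not> (c \<in> B0 \<and> b \<in> B0)" for b c
    proof (cases "c \<in> B0")
      case False
      have "lin_ext (*) (\<lambda>(x, y). ?r x c * ?r y b) p = ?r (lin_ext scale (\<lambda>(x, y). scale (?r y b) x) p) c"
        by (subst linear_lin_ext_comm[OF lin]) (simp add: case_prod_unfold linear_scaleD[OF lin] mult.commute)
      then show ?thesis using rC[OF left[OF lin] False] by simp
    next
      case True
      have "lin_ext (*) (\<lambda>(x, y). ?r x c * ?r y b) p = ?r (lin_ext scale (\<lambda>(x, y). scale (?r x c) y) p) b"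
        by (subst linear_lin_ext_comm[OF lin]) (simp add: case_prod_unfold linear_scaleD[OF lin])
      then show ?thesis using rC[OF right[OF lin]] True that by simp
    qed
    have "Poly_Mapping.lookup (\<Phi> p) k = 0" if "k \<notin> B0 \<times> B0" for k
      unfolding \<Phi>_def lookup_sum
    proof (intro sum.neutral ballI)
      fix c b
      show "Poly_Mapping.lookup (free_scale (lin_ext (*) (\<lambda>(x, y). ?r x c * ?r y b) p) (free_gen (c, b))) k = 0"
        using that by (cases "c \<in> B0 \<and> b \<in> B0") (auto simp: z lookup_single when_def)
    qed
    then have "Poly_Mapping.keys (\<Phi> p) \<subseteq> B0 \<times> B0"
      unfolding subset_iff in_keys_iff by blast
    then show ?thesis using B0 by auto
  qed
  ultimately show ?thesis by (rule that[rotated])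
qed

end

section \<open>Nilpotency of the augmentation ideal of the dual algebra\<close>

locale fd_bialgebra = bialgebra scale \<Delta> \<epsilon> + finite_dimensional_vector_space scale Basis
  for scale :: "'k::field \<Rightarrow> 'h::ring_1 \<Rightarrow> 'h"
    and \<Delta> :: "'h \<Rightarrow> (('h \<times> 'h) \<Rightarrow>\<^sub>0 'k)"
    and \<epsilon> :: "'h \<Rightarrow> 'k"
    and Basis :: "'h set"
begin

lemma subcoalgebraI:
  assumes "subspace C" "\<And>F x. functional F \<Longrightarrow> x \<in> C \<Longrightarrow> lhit F x \<in> C"
    "\<And>F x. functional F \<Longrightarrow> x \<in> C \<Longrightarrow> rhit x F \<in> C"
  shows "subcoalgebra C"
  unfolding subcoalgebra_def
proof (intro conjI ballI)
  fix x assume "x \<in> C"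
  then obtain q where "Poly_Mapping.keys q \<subseteq> C \<times> C" "tensor2_eq scale (\<Delta> x) q"
    using assms(2,3)[of _ x] tensor2_in_subspace[OF assms(1), of "\<Delta> x"]
    unfolding lhit_def rhit_def sw_def by blast
  then show "\<exists>q. Poly_Mapping.keys q \<subseteq> C \<times> C \<and> tensor2_eq scale (\<Delta> x) q"
    by blast
qed fact

lemma subcoalgebra_span_one: "subcoalgebra (span {1})"
proof (rule subcoalgebraI)
  fix F x assume F: "functional F" and "x \<in> span {1}"
  then obtain c where x: "x = scale c 1" by (auto simp: span_singleton)
  show "lhit F x \<in> span {1}"
    unfolding x linear_scaleD[OF linear_lhit[OF F]] lhit_one[OF F] by (intro span_scale span_base) simp
  show "rhit x F \<in> span {1}"
    unfolding x linear_scaleD[OF linear_rhit[OF F]] rhit_one[OF F] by (intro span_scale span_base) simp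
qed simp

lemma subspace_of_span_one:
  assumes "subspace D" "D \<subseteq> span {1}" "D \<noteq> {0}"
  shows "D = span {1}"
proof -
  obtain d where d: "d \<in> D" "d \<noteq> 0" using assms subspace_0 by blast
  then obtain c where "d = scale c 1" using assms by (auto simp: span_singleton)
  with d have "1 = scale (inverse c) d" by auto
  with d assms(1) have "1 \<in> D" using subspace_scale by metis
  then have "span {1} \<subseteq> D" using assms(1) by (intro span_minimal) auto
  with assms show ?thesis by auto
qed

lemma simple_subcoalgebra_span_one: "simple_subcoalgebra (span {1})"
proof -
  have "(1::'h) \<in> span {1}" by (intro span_base) simp
  then have "span {1} \<noteq> {0::'h}" by fastforce
  moreover have "D = {0} \<or> D = span {1}" if "subcoalgebra D" "D \<subseteq> span {1}" for D
    using that subspace_of_span_one[of D] by (auto simp: subcoalgebra_def)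
  ultimately show ?thesis
    by (simp add: simple_subcoalgebra_def subcoalgebra_span_one)
qed

text \<open>Equivalently, the comultiplication maps \<open>U\<close> into U \<otimes> H; these are
  the submodules of H for the left action of the dual algebra.\<close>

definition right_coideal :: "'h set \<Rightarrow> bool" where
  "right_coideal U \<longleftrightarrow> subspace U \<and> (\<forall>F x. functional F \<longrightarrow> x \<in> U \<longrightarrow> lhit F x \<in> U)"

text \<open>Evaluation at 1 is the augmentation of the dual algebra, so this is membership in its
  augmentation ideal J.\<close>

definition aug :: "('h \<Rightarrow> 'k) \<Rightarrow> bool" where
  "aug F \<longleftrightarrow> functional F \<and> F 1 = 0"

text \<open>The submodule J \<rightharpoonup> U. Once J is known to be nilpotent, it is the radical
  of \<open>U\<close> as a module over the dual algebra.\<close>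

definition rad :: "'h set \<Rightarrow> 'h set" where
  "rad U = span {lhit F x | F x. aug F \<and> x \<in> U}"

lemma conv_one: "functional F \<Longrightarrow> functional G \<Longrightarrow> convk F G 1 = F 1 * G 1"
  unfolding conv_def
  by (rule sw_one) (intro vector_space_mult algebra_over_field.bilinear_mult algebra_mult)+

lemma augD: "aug F \<Longrightarrow> functional F" "aug F \<Longrightarrow> F 1 = 0"
  by (auto simp: aug_def)

lemma aug_conv: "aug F \<Longrightarrow> functional G \<Longrightarrow> aug (convk F G)" "functional G \<Longrightarrow> aug F \<Longrightarrow> aug (convk G F)"
  by (auto simp: aug_def functional_conv conv_one)

lemma right_coidealD: "right_coideal U \<Longrightarrow> subspace U" "right_coideal U \<Longrightarrow> functional F \<Longrightarrow> x \<in> U \<Longrightarrow> lhit F x \<in> U"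
  by (auto simp: right_coideal_def)

lemma right_coideal_UNIV: "right_coideal UNIV"
  by (simp add: right_coideal_def)

lemma rad_subset: "right_coideal U \<Longrightarrow> rad U \<subseteq> U"
  unfolding rad_def by (rule span_minimal) (auto simp: right_coidealD augD)

lemma right_coideal_span:
  assumes "\<And>F x. functional F \<Longrightarrow> x \<in> A \<Longrightarrow> lhit F x \<in> span A"
  shows "right_coideal (span A)"
  unfolding right_coideal_def
proof (intro conjI allI impI)
  fix F x assume F: "functional F" and x: "x \<in> span A"
  from linear_lhit[OF F] interpret L: Vector_Spaces.linear scale scale "lhit F" .
  have "subspace {x. lhit F x \<in> span A}"
    using L.subspace_vimage[OF subspace_span] by (simp add: vimage_def)
  then have "span A \<subseteq> {x. lhit F x \<in> span A}"
    using assms[OF F] by (intro span_minimal) auto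
  with x show "lhit F x \<in> span A" by auto
qed simp

lemma right_coideal_rad:
  assumes "right_coideal U"
  shows "right_coideal (rad U)"
  unfolding rad_def
proof (rule right_coideal_span)
  fix G y assume G: "functional G" and "y \<in> {lhit F x | F x. aug F \<and> x \<in> U}"
  then obtain F x where y: "y = lhit F x" "aug F" "x \<in> U" by auto
  then have "lhit G y = lhit (convk G F) x" "aug (convk G F)"
    using G by (auto simp: lhit_lhit augD aug_conv)
  with y show "lhit G y \<in> span {lhit F x | F x. aug F \<and> x \<in> U}"
    by (auto intro!: span_base)
qed

text \<open>The right action of a fixed functional commutes with the left action, so it is an
  endomorphism of left modules. Its images of \<open>U\<close> serve below as smaller copies and as
  translates.\<close>

lemma right_coideal_rhit_image:
  assumes "right_coideal U" and f: "functional f"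
  shows "right_coideal ((\<lambda>x. rhit x f) ` U)"
proof -
  from linear_rhit[OF f] interpret L: Vector_Spaces.linear scale scale "\<lambda>x. rhit x f" .
  show ?thesis
    using assms by (auto simp: right_coideal_def lhit_rhit intro: L.subspace_image)
qed

lemma rad_rhit_image:
  assumes f: "functional f"
  shows "rad ((\<lambda>x. rhit x f) ` U) = (\<lambda>x. rhit x f) ` rad U"
proof -
  from linear_rhit[OF f] interpret L: Vector_Spaces.linear scale scale "\<lambda>x. rhit x f" .
  have "{lhit F x | F x. aug F \<and> x \<in> (\<lambda>x. rhit x f) ` U} = (\<lambda>x. rhit x f) ` {lhit F x | F x. aug F \<and> x \<in> U}"
    by (force simp: lhit_rhit f augD)
  then show ?thesis unfolding rad_def L.span_image[symmetric] by simp
qed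

lemma right_coideal_sum:
  assumes "right_coideal U" "right_coideal V"
  shows "right_coideal {x + y | x y. x \<in> U \<and> y \<in> V}"
proof -
  have "lhit F z \<in> {x + y | x y. x \<in> U \<and> y \<in> V}" if F: "functional F" and "z \<in> {x + y | x y. x \<in> U \<and> y \<in> V}" for F z
  proof -
    from that obtain x y where "z = x + y" "x \<in> U" "y \<in> V" by auto
    then have "lhit F z = lhit F x + lhit F y" "lhit F x \<in> U" "lhit F y \<in> V"
      using assms F by (auto simp: linear_addD[OF linear_lhit[OF F]] right_coidealD)
    then show ?thesis by auto
  qed
  with assms show ?thesis by (simp add: right_coideal_def subspace_sums)
qed

end

locale connected_bialgebra = fd_bialgebra scale \<Delta> \<epsilon> Basis
  for scale :: "'k::field \<Rightarrow> 'h::ring_1 \<Rightarrow> 'h"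
    and \<Delta> :: "'h \<Rightarrow> (('h \<times> 'h) \<Rightarrow>\<^sub>0 'k)"
    and \<epsilon> :: "'h \<Rightarrow> 'k"
    and Basis :: "'h set" +
  assumes connected: connected
begin

text \<open>A nonzero subcoalgebra of least dimension inside \<open>C\<close> is simple and so lies
  in the coradical. The latter is the line through 1, because it has dimension one and contains
  1.\<close>

lemma one_in_subcoalgebra:
  assumes "subcoalgebra C" "C \<noteq> {0}"
  shows "1 \<in> C"
proof -
  let ?P = "\<lambda>D. subcoalgebra D \<and> D \<noteq> {0} \<and> D \<subseteq> C"
  obtain D where D: "?P D" and min: "\<And>D'. ?P D' \<Longrightarrow> dim D \<le> dim D'"
    using ex_has_least_nat[of ?P C dim] assms by blast
  have "D' = D" if "subcoalgebra D'" "D' \<subseteq> D" "D' \<noteq> {0}" for D'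
  proof (rule subspace_dim_equal)
    show "dim D \<le> dim D'" using that D by (intro min) blast
  qed (use that D in \<open>auto simp: subcoalgebra_def\<close>)
  with D have "simple_subcoalgebra D"
    unfolding simple_subcoalgebra_def by blast
  then have sub: "D \<subseteq> coradical"
    unfolding coradical_def by (intro subset_trans[OF _ span_superset]) auto
  have "(1::'h) \<in> span {1}" by (intro span_base) simp
  then have "1 \<in> coradical"
    unfolding coradical_def using simple_subcoalgebra_span_one by (intro span_base) auto
  then have one: "span {1} \<subseteq> coradical"
    unfolding coradical_def by (intro span_minimal) auto
  have "coradical = span {1}"
    using one connected by (intro subspace_dim_equal[symmetric]) (auto simp: connected_def coradical_def)
  with sub D have "D = span {1}"
    by (intro subspace_of_span_one) (auto simp: subcoalgebra_def)
  with D \<open>1 \<in> span {1}\<close> show ?thesis by auto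
qed

text \<open>
  A nonzero \<open>U = J \<rightharpoonup> U\<close> of least dimension is a simple right coideal: a functional vanishing on a
  smaller one would shrink it.  Its coefficients span a subcoalgebra, which contains \<open>1\<close>.  In that
  subcoalgebra let \<open>V\<close> be a right coideal which is maximal without \<open>1\<close>.  Modulo \<open>V\<close> some translate of
  \<open>U\<close> contains \<open>1\<close>, so by simplicity it is spanned by \<open>1\<close> and killed by \<open>J\<close>.
\<close>

lemma rad_stable_imp_zero:
  assumes "right_coideal K" "rad K = K"
  shows "K = {0}"
proof (rule ccontr)
  assume "K \<noteq> {0}"
  let ?P = "\<lambda>U. right_coideal U \<and> rad U = U \<and> U \<noteq> {0}"
  obtain U where U: "right_coideal U" "rad U = U" "U \<noteq> {0}" and min: "\<And>V. ?P V \<Longrightarrow> dim U \<le> dim V"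
    using ex_has_least_nat[of ?P K dim] assms \<open>K \<noteq> {0}\<close> by blast
  have subU: "subspace U" using U by (simp add: right_coidealD)
  have simple: "V = U" if V: "right_coideal V" "V \<subseteq> U" "V \<noteq> {0}" for V
  proof (rule ccontr)
    assume "V \<noteq> U"
    then obtain x where x: "x \<in> U" "x \<notin> V" using V by auto
    have subV: "subspace V" using V by (simp add: right_coidealD)
    obtain f where f: "functional f" "\<And>y. y \<in> V \<Longrightarrow> f y = 0" "f x = 1"
      using functional_separating[OF subV x(2)] by metis
    from linear_rhit[OF f(1)] interpret L: Vector_Spaces.linear scale scale "\<lambda>x. rhit x f" .
    let ?W = "(\<lambda>x. rhit x f) ` U"
    have "\<epsilon> (rhit x f) \<noteq> 0" using f by (simp add: counit_rhit)
    then have "rhit x f \<noteq> 0" using linear_zeroD[OF counit_linear] by auto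
    then have "?P ?W"
      using U x f by (auto simp: right_coideal_rhit_image rad_rhit_image)
    then have "dim U \<le> dim ?W" by (rule min)
    moreover have "dim ?W < dim U"
    proof -
      obtain v where v: "v \<in> V" "v \<noteq> 0" using V subspace_0[OF subV] by blast
      \<comment> \<open>Testing with \<open>G\<close> moves the action to the other side: the value
        is \<open>f (lhit G v)\<close>, and \<open>lhit G v\<close> stays in \<open>V\<close>, where
        \<open>f\<close> vanishes. So the translation by \<open>f\<close> has a kernel and lowers
        the dimension.\<close>
      have zero: "rhit v f = 0"
      proof (rule functional_eqI)
        fix G assume G: "functional G"
        have "G (rhit v f) = f (lhit G v)"
          using f(1) G by (simp add: functional_rhit functional_lhit)
        also have "\<dots> = 0" using V v G by (intro f) (simp add: right_coidealD)
        finally show "G (rhit v f) = G 0" by (simp add: linear_zeroD[OF G])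
      qed
      have "independent {v}" using v by simp
      then obtain B where B: "{v} \<subseteq> B" "B \<subseteq> U" "independent B" "U \<subseteq> span B"
        using maximal_independent_subset_extend[of "{v}" U] v V by auto
      have fin: "finite B" using B by (simp add: finiteI_independent)
      have "?W \<subseteq> span ((\<lambda>x. rhit x f) ` B)"
        using B(4) unfolding L.span_image by auto
      also have "(\<lambda>x. rhit x f) ` B = insert 0 ((\<lambda>x. rhit x f) ` (B - {v}))"
        using B(1) zero by force
      finally have "?W \<subseteq> span ((\<lambda>x. rhit x f) ` (B - {v}))" by simp
      then have "dim ?W \<le> card ((\<lambda>x. rhit x f) ` (B - {v}))"
        using fin by (intro dim_le_card) auto
      also have "\<dots> \<le> card (B - {v})" using fin by (intro card_image_le) auto
      also have "\<dots> < card B" using B(1) fin by (intro psubset_card_mono) auto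
      also have "card B = dim U" using B by (intro basis_card_eq_dim) auto
      finally show ?thesis .
    qed
    ultimately show False by simp
  qed
  define C where "C = span {rhit x F | x F. x \<in> U \<and> functional F}"
  have C_base: "rhit x F \<in> C" if "x \<in> U" "functional F" for x F
    unfolding C_def using that by (intro span_base) auto
  have "right_coideal C"
    unfolding C_def
  proof (rule right_coideal_span)
    fix G y assume G: "functional G" and "y \<in> {rhit x F | x F. x \<in> U \<and> functional F}"
    then obtain x F where "y = rhit x F" "x \<in> U" "functional F" by auto
    then have "lhit G y = rhit (lhit G x) F" "lhit G x \<in> U"
      using U(1) G by (auto simp: lhit_rhit right_coidealD)
    with \<open>functional F\<close> show "lhit G y \<in> span {rhit x F | x F. x \<in> U \<and> functional F}"
      by (blast intro: span_base)
  qed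
  moreover have "rhit y G \<in> C" if G: "functional G" and "y \<in> C" for y G
  proof -
    from linear_rhit[OF G] interpret L: Vector_Spaces.linear scale scale "\<lambda>x. rhit x G" .
    have "subspace {x. rhit x G \<in> C}"
      using L.subspace_vimage[OF subspace_span] by (simp add: vimage_def C_def)
    moreover have "rhit (rhit x F) G \<in> C" if "x \<in> U" "functional F" for x F
      using that G by (simp add: rhit_rhit functional_conv C_base)
    ultimately have "C \<subseteq> {x. rhit x G \<in> C}"
      unfolding C_def[of] by (intro span_minimal) (auto simp: C_def)
    with that show ?thesis by auto
  qed
  ultimately have "subcoalgebra C"
    by (intro subcoalgebraI) (auto simp: right_coidealD)
  moreover have "U \<subseteq> C"
    using C_base[OF _ counit_linear] by (auto simp: rhit_counit)
  then have "C \<noteq> {0}" using U subspace_0[OF subU] by blast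
  ultimately have "1 \<in> C" by (rule one_in_subcoalgebra)
  let ?Q = "\<lambda>V. right_coideal V \<and> V \<subseteq> C \<and> 1 \<notin> V"
  have "?Q {0}"
    using \<open>right_coideal C\<close> by (auto simp: right_coideal_def linear_zeroD[OF linear_lhit] subspace_0)
  moreover have "\<forall>V. ?Q V \<longrightarrow> dim V < Suc dimension"
    using dim_subset_UNIV by (simp add: less_Suc_eq_le)
  ultimately have "\<exists>V. ?Q V \<and> (\<forall>V'. ?Q V' \<longrightarrow> dim V' \<le> dim V)"
    by (intro ex_has_greatest_nat[of ?Q "{0}" dim "Suc dimension"]) auto
  then obtain V where V: "right_coideal V" "V \<subseteq> C" "1 \<notin> V" and max: "\<And>V'. ?Q V' \<Longrightarrow> dim V' \<le> dim V"
    by blast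
  have subV: "subspace V" using V by (simp add: right_coidealD)
  have "\<exists>x F. x \<in> U \<and> functional F \<and> rhit x F \<notin> V"
  proof (rule ccontr)
    assume "\<not> ?thesis"
    then have "C \<subseteq> V" unfolding C_def using subV by (intro span_minimal) auto
    with \<open>1 \<in> C\<close> V show False by auto
  qed
  then obtain x0 f where x0: "x0 \<in> U" "rhit x0 f \<notin> V" and f: "functional f" by auto
  from linear_rhit[OF f] interpret L: Vector_Spaces.linear scale scale "\<lambda>x. rhit x f" .
  \<comment> \<open>Strictly larger than \<open>V\<close>, so the maximality of \<open>V\<close>
    puts 1 into it.\<close>
  define W where "W = {c + y | c y. c \<in> V \<and> y \<in> (\<lambda>x. rhit x f) ` U}"
  have W: "right_coideal W"
    unfolding W_def using V(1) U(1) f by (intro right_coideal_sum right_coideal_rhit_image)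
  have subC: "subspace C" by (simp add: C_def)
  have "W \<subseteq> C"
    unfolding W_def using V(2) f subC by (auto intro!: subspace_add C_base)
  have W_memI: "c + rhit x f \<in> W" if "c \<in> V" "x \<in> U" for c x
    unfolding W_def using that by blast
  have "V \<subseteq> W"
    using W_memI[OF _ subspace_0[OF subU]] by (auto simp: L.zero)
  moreover have "rhit x0 f \<in> W"
    using W_memI[OF subspace_0[OF subV] x0(1)] by simp
  ultimately have "V \<noteq> W" using x0(2) by blast
  have "1 \<in> W"
  proof (rule ccontr)
    assume "1 \<notin> W"
    with W \<open>W \<subseteq> C\<close> have "dim W \<le> dim V" by (intro max conjI)
    with \<open>V \<subseteq> W\<close> have "V = W"
      using subV W by (intro subspace_dim_equal) (auto simp: right_coidealD)
    with \<open>V \<noteq> W\<close> show False by simp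
  qed
  then obtain c1 x1 where x1: "1 = c1 + rhit x1 f" "c1 \<in> V" "x1 \<in> U"
    unfolding W_def by blast
  \<comment> \<open>The preimage in \<open>U\<close> of the span of 1 and \<open>V\<close>. It is a
    right coideal because functionals act on 1 by scalars, and it contains \<open>x1\<close>, so
    simplicity makes it all of \<open>U\<close>. Elements of J kill 1, so they move the translate of
    \<open>U\<close> into \<open>V\<close>.\<close>
  define U1 where "U1 = {x \<in> U. \<exists>a c. c \<in> V \<and> rhit x f = scale a 1 + c}"
  have U1_subset: "U1 \<subseteq> U" by (auto simp: U1_def)
  have "right_coideal U1"
    unfolding right_coideal_def
  proof (intro conjI allI impI)
    show "subspace U1"
    proof (rule subspaceI)
      show "0 \<in> U1"
        using subspace_0[OF subU] subspace_0[OF subV]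
        by (auto simp: U1_def L.zero intro!: exI[of _ "0::'k"] exI[of _ "0::'h"])
      fix x y assume "x \<in> U1" "y \<in> U1"
      then obtain a c a' c' where "x \<in> U" "y \<in> U" "c \<in> V" "c' \<in> V"
        "rhit x f = scale a 1 + c" "rhit y f = scale a' 1 + c'" by (auto simp: U1_def)
      then have "x + y \<in> U" "c + c' \<in> V" "rhit (x + y) f = scale (a + a') 1 + (c + c')"
        using subU subV by (auto simp: L.add scale_left_distrib subspace_add)
      then show "x + y \<in> U1" unfolding U1_def by blast
    next
      fix x b assume "x \<in> U1"
      then obtain a c where "x \<in> U" "c \<in> V" "rhit x f = scale a 1 + c" by (auto simp: U1_def)
      then have "scale b x \<in> U" "scale b c \<in> V" "rhit (scale b x) f = scale (b * a) 1 + scale b c"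
        using subU subV by (auto simp: L.scale scale_right_distrib subspace_scale)
      then show "scale b x \<in> U1" unfolding U1_def by blast
    qed
  next
    fix F x assume F: "functional F" and "x \<in> U1"
    then obtain a c where x: "x \<in> U" "c \<in> V" "rhit x f = scale a 1 + c" by (auto simp: U1_def)
    have "rhit (lhit F x) f = lhit F (scale a 1 + c)"
      using F f x by (simp add: lhit_rhit[symmetric])
    also have "\<dots> = scale (a * F 1) 1 + lhit F c"
      by (simp add: linear_addD[OF linear_lhit[OF F]] linear_scaleD[OF linear_lhit[OF F]] lhit_one[OF F])
    finally have "rhit (lhit F x) f = scale (a * F 1) 1 + lhit F c" .
    moreover have "lhit F x \<in> U" "lhit F c \<in> V" using x U V F by (auto simp: right_coidealD)
    ultimately show "lhit F x \<in> U1" unfolding U1_def by blast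
  qed
  moreover have "x1 \<in> U1"
  proof -
    have "rhit x1 f = scale 1 1 + (- c1)" using x1(1) by (simp add: algebra_simps)
    moreover have "- c1 \<in> V" using x1 subV by (simp add: subspace_neg)
    ultimately show ?thesis using x1 unfolding U1_def by blast
  qed
  moreover have "x1 \<noteq> 0" using x1 V by (auto simp: L.zero)
  ultimately have "U1 = U"
    using simple[of U1] U1_subset by blast
  have "subspace {x. rhit x f \<in> V}"
    using L.subspace_vimage[OF subV] by (simp add: vimage_def)
  moreover have "rhit (lhit F x) f \<in> V" if F: "aug F" and "x \<in> U" for F x
  proof -
    from that \<open>U1 = U\<close> have "x \<in> U1" by simp
    then obtain a c where x: "c \<in> V" "rhit x f = scale a 1 + c" unfolding U1_def by blast
    have "rhit (lhit F x) f = lhit F (scale a 1 + c)"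
      using F f x by (simp add: lhit_rhit[symmetric] augD)
    also have "\<dots> = lhit F c"
      using F by (simp add: linear_addD[OF linear_lhit[OF augD(1)[OF F]]]
          linear_scaleD[OF linear_lhit[OF augD(1)[OF F]]] lhit_one[OF augD(1)[OF F]] augD)
    finally show ?thesis using V x F by (auto simp: right_coidealD augD)
  qed
  ultimately have "rad U \<subseteq> {x. rhit x f \<in> V}"
    unfolding rad_def by (intro span_minimal) auto
  with U x0 show False by auto
qed

text \<open>A nonzero term of the descending chain cannot equal its successor, so each step costs at
  least one dimension.\<close>

lemma rad_nilpotent: "\<exists>m. (rad ^^ m) UNIV = {0}"
proof (rule ccontr)
  assume nz: "\<not> ?thesis"
  let ?U = "\<lambda>m. (rad ^^ m) UNIV"
  have co: "right_coideal (?U m)" for m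
    by (induction m) (auto simp: right_coideal_UNIV right_coideal_rad)
  have "dim (?U (Suc m)) < dim (?U m)" for m
  proof -
    have "?U (Suc m) \<subseteq> ?U m" using rad_subset[OF co] by simp
    moreover have "?U (Suc m) \<noteq> ?U m" using rad_stable_imp_zero[OF co, of m] nz by auto
    ultimately show ?thesis
      using subspace_dim_equal[OF right_coidealD(1)[OF co] right_coidealD(1)[OF co], of "Suc m" m] by linarith
  qed
  note less = this
  have "dim (?U m) + m \<le> dim UNIV" for m
  proof (induction m)
    case (Suc m)
    then show ?case using less[of m] by linarith
  qed simp
  from this[of "Suc (dim UNIV)"] show False by simp
qed

end

section \<open>The coradical filtration\<close>

context connected_bialgebra
begin

text \<open>
  As \<open>aug_words n\<close> spans \<open>J\<^sup>n\<close> for \<open>n > 0\<close>, \<open>filt n\<close> is the annihilator of \<open>J\<close> to the power \<open>n + 1\<close>, that is,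
  the \<open>n\<close>-th term of the coradical filtration.
\<close>

primrec aug_words :: "nat \<Rightarrow> ('h \<Rightarrow> 'k) set" where
  "aug_words 0 = {\<epsilon>}"
| "aug_words (Suc n) = {convk F G | F G. aug F \<and> G \<in> aug_words n}"

definition filt :: "nat \<Rightarrow> 'h set" where
  "filt n = {y. \<forall>F\<in>aug_words (Suc n). F y = 0}"

lemma convk_counit: "functional F \<Longrightarrow> convk \<epsilon> F = F" "functional F \<Longrightarrow> convk F \<epsilon> = F"
  using conv_unit_left[OF algebra_mult, of F] conv_unit_right[OF algebra_mult, of F] by simp_all

lemma convk_assoc: "functional F \<Longrightarrow> functional G \<Longrightarrow> functional H \<Longrightarrow> convk (convk F G) H = convk F (convk G H)"
  by (rule conv_assoc[OF algebra_mult])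

lemma functional_aug_words: "F \<in> aug_words n \<Longrightarrow> functional F"
  by (induction n arbitrary: F) (auto simp: counit_linear augD functional_conv)

lemma aug_words_append: "F \<in> aug_words m \<Longrightarrow> G \<in> aug_words n \<Longrightarrow> convk F G \<in> aug_words (m + n)"
proof (induction m arbitrary: F)
  case 0
  then show ?case by (simp add: convk_counit functional_aug_words)
next
  case (Suc m)
  then obtain F1 F2 where F: "F = convk F1 F2" "aug F1" "F2 \<in> aug_words m" by auto
  then have "convk F G = convk F1 (convk F2 G)"
    using Suc.prems by (simp add: convk_assoc functional_aug_words augD)
  with Suc.IH[OF F(3) Suc.prems(2)] F(2) show ?case by auto
qed

lemma aug_imp_word: "aug F \<Longrightarrow> F \<in> aug_words (Suc 0)"
  using convk_counit(2)[of F, symmetric] by (auto simp: augD)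

lemma aug_words_Suc_one: "F \<in> aug_words (Suc n) \<Longrightarrow> F 1 = 0"
  by (auto simp: conv_one augD functional_aug_words)

lemma subspace_filt: "subspace (filt n)"
proof (rule subspaceI)
  show "0 \<in> filt n"
    unfolding filt_def using functional_aug_words[THEN linear_zeroD] by blast
  show "x + y \<in> filt n" if "x \<in> filt n" "y \<in> filt n" for x y
    using that by (auto simp: filt_def functional_aug_words[THEN linear_addD] simp del: aug_words.simps)
  show "scale c x \<in> filt n" if "x \<in> filt n" for c x
    using that by (auto simp: filt_def functional_aug_words[THEN linear_scaleD] simp del: aug_words.simps)
qed

lemma one_in_filt: "1 \<in> filt n"
  using aug_words_Suc_one unfolding filt_def by blast

lemma filt_0: "filt 0 = span {1}"
proof
  show "span {1} \<subseteq> filt 0"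
    using one_in_filt subspace_filt by (intro span_minimal) auto
  show "filt 0 \<subseteq> span {1}"
  proof (rule subsetI, rule ccontr)
    fix x assume x: "x \<in> filt 0" and "x \<notin> span {1}"
    then obtain F where F: "functional F" "\<And>y. y \<in> span {1} \<Longrightarrow> F y = 0" "F x = 1"
      using functional_separating[OF subspace_span] by metis
    then have "aug F" by (simp add: aug_def span_base)
    then show False using x F(3) aug_imp_word unfolding filt_def by force
  qed
qed

lemma lhit_filt:
  assumes "aug F" "x \<in> filt (Suc n)"
  shows "lhit F x \<in> filt n"
proof -
  have "G (lhit F x) = 0" if G: "G \<in> aug_words (Suc n)" for G
  proof -
    have "convk G F \<in> aug_words (Suc (Suc n))"
      using aug_words_append[OF G aug_imp_word[OF assms(1)]] by simp
    then have "convk G F x = 0" using assms(2) unfolding filt_def by blast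
    then show ?thesis using functional_lhit[OF augD(1)[OF assms(1)] functional_aug_words[OF G]] by simp
  qed
  then show ?thesis unfolding filt_def by blast
qed

lemma rhit_filt:
  assumes "aug F" "x \<in> filt (Suc n)"
  shows "rhit x F \<in> filt n"
proof -
  have "G (rhit x F) = 0" if G: "G \<in> aug_words (Suc n)" for G
  proof -
    have "convk F G \<in> aug_words (Suc (Suc n))"
      using assms(1) G by (subst aug_words.simps) blast
    then have "convk F G x = 0" using assms(2) unfolding filt_def by blast
    then show ?thesis using functional_rhit[OF augD(1)[OF assms(1)] functional_aug_words[OF G]] by simp
  qed
  then show ?thesis unfolding filt_def by blast
qed

text \<open>Words of length m act as zero on H, and the counit recovers F(x) from F
  \<rightharpoonup> x, so these words vanish as functionals. The words of length m + 1 tested by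
  \<open>filt m\<close> have such a word as a factor.\<close>

lemma filt_exhausts: "\<exists>m. filt m = UNIV"
proof -
  obtain m where m: "(rad ^^ m) UNIV = {0}" using rad_nilpotent by blast
  have "lhit F x \<in> (rad ^^ n) UNIV" if "F \<in> aug_words n" for F x n
    using that
  proof (induction n arbitrary: F)
    case (Suc n)
    then obtain G H where F: "F = convk G H" "aug G" "H \<in> aug_words n" by auto
    then have "lhit F x = lhit G (lhit H x)"
      by (simp add: lhit_lhit augD functional_aug_words)
    moreover have "lhit H x \<in> (rad ^^ n) UNIV" by (rule Suc.IH) fact
    ultimately have "lhit F x \<in> rad ((rad ^^ n) UNIV)"
      using F(2) unfolding rad_def by (intro span_base) blast
    then show ?case by simp
  qed simp
  from this[of _ m] have "lhit F x = 0" if "F \<in> aug_words m" for F x using that m by blast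
  then have zero: "F x = 0" if "F \<in> aug_words m" for F x
    using counit_lhit[OF functional_aug_words[OF that], of x] that linear_zeroD[OF counit_linear] by simp
  have "F x = 0" if "F \<in> aug_words (Suc m)" for F x
  proof -
    from that obtain G H where F: "F = convk G H" "aug G" "H \<in> aug_words m" by auto
    have "convk G H x = sw (*) (\<lambda>a b. 0) x"
      by (simp add: conv_def zero[OF F(3)])
    also have "\<dots> = 0" by (simp add: sw_def lin_ext_fun_zero vector_space_mult case_prod_unfold)
    finally show ?thesis using F by simp
  qed
  then show ?thesis unfolding filt_def by blast
qed

text \<open>Subtracting the multiple F(1) of \<epsilon> moves a functional F into J, and J lowers
  the filtration degree of \<open>x\<close> by one. A slice of \<open>?p\<close> is therefore an
  element of \<open>filt n\<close> minus F(x) times 1, which also lies in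
  \<open>filt n\<close>.\<close>

lemma comult_filt:
  assumes "x \<in> filt (Suc n)"
  obtains q where "Poly_Mapping.keys q \<subseteq> filt n \<times> filt n"
    "tensor2_eq scale (\<Delta> x) (free_gen (x, 1) + free_gen (1, x) + q)"
proof -
  let ?p = "\<Delta> x - free_gen (x, 1) - free_gen (1, x)"
  have sp: "aug (\<lambda>y. F y - F 1 * \<epsilon> y)" if "functional F" for F
    using that by (auto simp: aug_def counit_one
      intro!: linear_minus linear_scale_const[of _ "(*)", OF counit_linear])
  have l: "lin_ext scale (\<lambda>(a, b). scale (F b) a) ?p \<in> filt n" if F: "functional F" for F
  proof -
    have "lhit F x = lhit (\<lambda>y. F y - F 1 * \<epsilon> y) x + scale (F 1) (lhit \<epsilon> x)"
      unfolding lhit_def by (simp add: sw_scale_fun sw_add_fun[symmetric] scale_left_distrib[symmetric])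
    then have "lin_ext scale (\<lambda>(a, b). scale (F b) a) ?p = lhit (\<lambda>y. F y - F 1 * \<epsilon> y) x - scale (F x) 1"
      by (simp add: lin_ext_diff lhit_counit) (simp add: lhit_def sw_def)
    then show ?thesis
      using lhit_filt[OF sp[OF F] assms] one_in_filt subspace_filt
      by (simp add: subspace_diff subspace_scale)
  qed
  have r: "lin_ext scale (\<lambda>(a, b). scale (F a) b) ?p \<in> filt n" if F: "functional F" for F
  proof -
    have "rhit x F = rhit x (\<lambda>y. F y - F 1 * \<epsilon> y) + scale (F 1) (rhit x \<epsilon>)"
      unfolding rhit_def by (simp add: sw_scale_fun sw_add_fun[symmetric] scale_left_distrib[symmetric])
    then have "lin_ext scale (\<lambda>(a, b). scale (F a) b) ?p = rhit x (\<lambda>y. F y - F 1 * \<epsilon> y) - scale (F x) 1"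
      by (simp add: lin_ext_diff rhit_counit) (simp add: rhit_def sw_def)
    then show ?thesis
      using rhit_filt[OF sp[OF F] assms] one_in_filt subspace_filt
      by (simp add: subspace_diff subspace_scale)
  qed
  obtain q where q: "Poly_Mapping.keys q \<subseteq> filt n \<times> filt n" "tensor2_eq scale ?p q"
    using tensor2_in_subspace[OF subspace_filt l r] by blast
  from q(2) have "tensor2_eq scale (\<Delta> x) (free_gen (x, 1) + free_gen (1, x) + q)"
    by (simp add: tensor2_eq_def algebra_simps)
  with q(1) show ?thesis by (rule that)
qed

lemma sw_filt:
  assumes "x \<in> filt (Suc n)"
  obtains q where "Poly_Mapping.keys q \<subseteq> filt n \<times> filt n"
    "\<And>t \<beta>. vector_space t \<Longrightarrow> bilinear scale t \<beta>
      \<Longrightarrow> sw t \<beta> x = \<beta> x 1 + \<beta> 1 x + lin_ext t (\<lambda>(a, b). \<beta> a b) q"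
proof -
  obtain q where q: "Poly_Mapping.keys q \<subseteq> filt n \<times> filt n"
    "tensor2_eq scale (\<Delta> x) (free_gen (x, 1) + free_gen (1, x) + q)"
    using comult_filt[OF assms] by metis
  show ?thesis
    by (rule that[OF q(1)]) (simp add: sw_tensor2_eq[OF _ _ q(2)] lin_ext_add)
qed

end

section \<open>The dual algebra over an extension field\<close>

text \<open>For an orbit \<open>s i\<close> = \<open>(T ^^ i) v\<close> this is the value at v of
  the polynomial P in T. Keeping the sequence instead of T covers orbits in H, orbits of
  functionals, and the functionals obtained from an orbit in H; shifting the sequence plays the role
  of multiplication by the variable.\<close>

definition polysum ::
    "('k::field \<Rightarrow> 'v::ab_group_add \<Rightarrow> 'v) \<Rightarrow> 'k poly \<Rightarrow> (nat \<Rightarrow> 'v) \<Rightarrow> 'v" where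
  "polysum scale P s = (\<Sum>i\<le>degree P. scale (coeff P i) (s i))"

context vector_space
begin

lemma polysum_bound: "degree P \<le> n \<Longrightarrow> polysum scale P s = (\<Sum>i\<le>n. scale (coeff P i) (s i))"
  unfolding polysum_def by (rule sum.mono_neutral_left) (auto simp: coeff_eq_0)

lemma polysum_0 [simp]: "polysum scale 0 s = 0"
  by (simp add: polysum_def)

lemma polysum_diff: "polysum scale (P - Q) s = polysum scale P s - polysum scale Q s"
proof -
  let ?n = "max (degree P) (degree Q)"
  have "degree (P - Q) \<le> ?n" by (rule degree_diff_le_max)
  then show ?thesis
    by (simp add: polysum_bound[of _ ?n] scale_left_diff_distrib sum_subtractf)
qed

lemma polysum_smult: "polysum scale (smult c P) s = scale c (polysum scale P s)"
  by (simp add: polysum_bound[OF degree_smult_le] polysum_def scale_sum_right)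

lemma polysum_pCons: "polysum scale (pCons c P) s = scale c (s 0) + polysum scale P (\<lambda>i. s (Suc i))"
proof -
  have "polysum scale (pCons c P) s = (\<Sum>i\<le>Suc (degree P). scale (coeff (pCons c P) i) (s i))"
    by (rule polysum_bound) (rule degree_pCons_le)
  then show ?thesis
    by (subst (asm) sum.atMost_Suc_shift) (simp add: polysum_def)
qed

lemma polysum_linear_factor:
  "polysum scale ([:- \<mu>, 1:] * P) s = polysum scale P (\<lambda>i. s (Suc i)) - scale \<mu> (polysum scale P s)"
proof -
  have "[:- \<mu>, 1:] * P = pCons 0 P - smult \<mu> P" by simp
  then show ?thesis by (simp only: polysum_diff polysum_pCons polysum_smult scale_zero_left add_0)
qed

lemma polysum_monom: "polysum scale (monom 1 n) s = s n"
proof -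
  have "polysum scale (monom 1 n) s = (\<Sum>i\<le>n. if i = n then s n else 0)"
    unfolding polysum_bound[OF degree_monom_le] by (rule sum.cong) auto
  then show ?thesis by simp
qed

text \<open>Among the first \<open>card B\<close> + 1 terms there is a linear relation. A repeated
  value is treated apart, since dependence of the set of values is informative only for distinct
  terms.\<close>

lemma exists_annihilating_poly:
  assumes "finite B" "\<And>i. s i \<in> span B"
  shows "\<exists>P. P \<noteq> 0 \<and> polysum scale P s = 0"
proof (cases "inj s")
  case False
  then obtain i j where ij: "i \<noteq> j" "s i = s j" by (auto simp: inj_def)
  let ?P = "monom 1 i - monom 1 j :: 'a poly"
  have "coeff ?P i \<noteq> 0" using ij by simp
  then have "?P \<noteq> 0" by force
  with ij show ?thesis by (intro exI[of _ ?P]) (simp add: polysum_diff polysum_monom)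
next
  case True
  let ?A = "s ` {..card B}"
  have "card ?A = Suc (card B)" using True by (simp add: card_image inj_on_subset)
  moreover have "?A \<subseteq> span B" using assms by auto
  ultimately have "dependent ?A"
    using independent_span_bound[OF assms(1), of ?A] by force
  then obtain u where u: "(\<Sum>v\<in>?A. scale (u v) v) = 0" "\<exists>v\<in>?A. u v \<noteq> 0"
    using dependent_finite[of ?A] by auto
  let ?P = "\<Sum>i\<le>card B. monom (u (s i)) i"
  have co: "coeff ?P i = (if i \<le> card B then u (s i) else 0)" for i
    by (simp add: coeff_sum)
  from u(2) obtain i where "i \<le> card B" "u (s i) \<noteq> 0" by auto
  then have "coeff ?P i \<noteq> 0" by (simp add: co)
  then have "?P \<noteq> 0" by (metis coeff_0)
  moreover have "polysum scale ?P s = (\<Sum>i\<le>card B. scale (u (s i)) (s i))"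
    by (subst polysum_bound[of _ "card B"]) (auto simp: co intro!: degree_sum_le order.trans[OF degree_monom_le])
  then have "polysum scale ?P s = 0"
    using u(1) True by (simp add: sum.reindex inj_on_subset)
  ultimately show ?thesis by blast
qed

end

text \<open>The normalization of \<Lambda> lets evaluation at \<Lambda> detect the unit of the dual
  algebra, whose value there is 1.\<close>

locale integral_bialgebra = connected_bialgebra scale \<Delta> \<epsilon> Basis
  for scale :: "'k::field \<Rightarrow> 'h::ring_1 \<Rightarrow> 'h"
    and \<Delta> :: "'h \<Rightarrow> (('h \<times> 'h) \<Rightarrow>\<^sub>0 'k)"
    and \<epsilon> :: "'h \<Rightarrow> 'k"
    and Basis :: "'h set" +
  fixes \<Lambda> :: 'h
  assumes integral: "h * \<Lambda> = scale (\<epsilon> h) \<Lambda>"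
    and counit_integral: "\<epsilon> \<Lambda> = 1"
begin

definition primitive :: "'h \<Rightarrow> bool" where
  "primitive x \<longleftrightarrow> tensor2_eq scale (\<Delta> x) (free_gen (x, 1) + free_gen (1, x))"

lemma sw_primitive:
  "primitive x \<Longrightarrow> vector_space t \<Longrightarrow> bilinear scale t \<beta> \<Longrightarrow> sw t \<beta> x = \<beta> x 1 + \<beta> 1 x"
  unfolding primitive_def by (simp add: sw_tensor2_eq lin_ext_add)

lemma counit_primitive:
  assumes "primitive x"
  shows "\<epsilon> x = 0"
proof -
  have "\<epsilon> x = convk \<epsilon> \<epsilon> x" by (simp add: convk_counit counit_linear)
  also have "\<dots> = \<epsilon> x + \<epsilon> x"
    unfolding conv_def using assms
    by (subst sw_primitive)
       (auto simp: counit_one vector_space_mult algebra_mult algebra_over_field.bilinear_mult counit_linear)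
  finally have "\<epsilon> x + 0 = \<epsilon> x + \<epsilon> x" by simp
  then show ?thesis by (simp only: add_left_cancel)
qed

end

text \<open>\<open>Func\<close> is the dual algebra of \<open>H\<close> after extension of scalars along \<open>\<iota>\<close>.\<close>

locale scalar_extension = integral_bialgebra scale \<Delta> \<epsilon> Basis \<Lambda>
  for scale :: "'k::field \<Rightarrow> 'h::ring_1 \<Rightarrow> 'h"
    and \<Delta> :: "'h \<Rightarrow> (('h \<times> 'h) \<Rightarrow>\<^sub>0 'k)"
    and \<epsilon> :: "'h \<Rightarrow> 'k"
    and Basis :: "'h set"
    and \<Lambda> :: 'h +
  fixes \<iota> :: "'k \<Rightarrow> 'e::alg_closed_field"
  assumes \<iota>_add: "\<iota> (x + y) = \<iota> x + \<iota> y"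
    and \<iota>_mult: "\<iota> (x * y) = \<iota> x * \<iota> y"
    and \<iota>_one: "\<iota> 1 = 1"
begin

definition scale_ext :: "'k \<Rightarrow> 'e \<Rightarrow> 'e" where "scale_ext c e = \<iota> c * e"

lemma \<iota>_zero [simp]: "\<iota> 0 = 0"
proof -
  have "\<iota> 0 + \<iota> 0 = \<iota> 0 + 0" using \<iota>_add[of 0 0] by simp
  then show ?thesis by (simp only: add_left_cancel)
qed

lemma \<iota>_eq_0_iff [simp]: "\<iota> x = 0 \<longleftrightarrow> x = 0"
proof
  assume "\<iota> x = 0"
  then have "\<iota> (x * inverse x) = 0" by (simp add: \<iota>_mult)
  then show "x = 0" using \<iota>_one by (cases "x = 0") auto
qed simp

lemma algebra_scale_ext: "algebra_over_field scale_ext"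
  by unfold_locales (auto simp: scale_ext_def \<iota>_add \<iota>_mult \<iota>_one algebra_simps)

lemma vector_space_scale_ext: "vector_space scale_ext"
  by (rule algebra_over_field.axioms(1)[OF algebra_scale_ext])

definition Func :: "('h \<Rightarrow> 'e) set" where "Func = {F. linear scale scale_ext F}"

definition unit :: "'h \<Rightarrow> 'e" where "unit x = \<iota> (\<epsilon> x)"

definition fscale :: "'e \<Rightarrow> ('h \<Rightarrow> 'e) \<Rightarrow> 'h \<Rightarrow> 'e" where "fscale c F x = c * F x"

abbreviation mul :: "('h \<Rightarrow> 'e) \<Rightarrow> ('h \<Rightarrow> 'e) \<Rightarrow> 'h \<Rightarrow> 'e" (infixl "\<star>" 70) where "F \<star> G \<equiv> conv scale_ext F G"

sublocale FS: vector_space fscale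
  by unfold_locales (auto simp: fun_eq_iff fscale_def algebra_simps)

lemma FuncD: "F \<in> Func \<Longrightarrow> linear scale scale_ext F" by (simp add: Func_def)

lemma Func_bilinear: "F \<in> Func \<Longrightarrow> G \<in> Func \<Longrightarrow> bilinear scale scale_ext (\<lambda>a b. F a * G b)"
  by (intro algebra_over_field.bilinear_mult algebra_scale_ext FuncD)

lemma unit_eq: "unit = (\<lambda>x. scale_ext (\<epsilon> x) 1)"
  by (auto simp: unit_def scale_ext_def)

lemma Func_intros [intro, simp]:
  shows Func_unit: "unit \<in> Func"
    and Func_mul: "F \<in> Func \<Longrightarrow> G \<in> Func \<Longrightarrow> F \<star> G \<in> Func"
    and Func_zero: "0 \<in> Func"
    and Func_add: "F \<in> Func \<Longrightarrow> G \<in> Func \<Longrightarrow> F + G \<in> Func"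
    and Func_diff: "F \<in> Func \<Longrightarrow> G \<in> Func \<Longrightarrow> F - G \<in> Func"
    and Func_scale: "F \<in> Func \<Longrightarrow> fscale c F \<in> Func"
    and Func_right: "F \<in> Func \<Longrightarrow> (\<lambda>x. F (x * a)) \<in> Func"
    and Func_left: "F \<in> Func \<Longrightarrow> (\<lambda>x. F (a * x)) \<in> Func"
proof -
  show "unit \<in> Func" unfolding unit_eq by (simp add: Func_def linear_unit algebra_scale_ext)
  assume F: "F \<in> Func"
  show "fscale c F \<in> Func"
    using FuncD[OF F] unfolding Func_def fscale_def
    by (auto intro!: linearI vector_space_axioms vector_space_scale_ext simp: linear_addD linear_scaleD scale_ext_def algebra_simps)
  show "(\<lambda>x. F (x * a)) \<in> Func" "(\<lambda>x. F (a * x)) \<in> Func"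
    using F by (auto simp: Func_def intro!: linear_compose[of scale scale_ext F] linear_intros algebra_over_field_axioms)
  assume G: "G \<in> Func"
  from F G show "F \<star> G \<in> Func" "F + G \<in> Func" "F - G \<in> Func"
    by (auto simp: Func_def plus_fun_def fun_diff_def intro!: linear_conv algebra_scale_ext linear_intros)
next
  show "0 \<in> Func" by (auto simp: Func_def zero_fun_def intro!: linear_intros vector_space_scale_ext)
qed

lemma mul_unit: "F \<in> Func \<Longrightarrow> unit \<star> F = F" "F \<in> Func \<Longrightarrow> F \<star> unit = F"
  by (simp_all add: unit_eq FuncD conv_unit_left conv_unit_right algebra_scale_ext)

lemma mul_assoc: "F \<in> Func \<Longrightarrow> G \<in> Func \<Longrightarrow> H \<in> Func \<Longrightarrow> F \<star> G \<star> H = F \<star> (G \<star> H)"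
  by (simp add: conv_assoc algebra_scale_ext FuncD)

lemma mul_add: "(F + G) \<star> H = F \<star> H + G \<star> H" "F \<star> (G + H) = F \<star> G + F \<star> H"
  by (simp_all add: fun_eq_iff conv_def algebra_simps sw_add_fun vector_space_scale_ext)

lemma mul_scale: "fscale c F \<star> G = fscale c (F \<star> G)" "F \<star> fscale c G = fscale c (F \<star> G)"
proof -
  have lin: "linear scale_ext scale_ext (\<lambda>x. c * x)"
    by (rule linearI) (auto simp: vector_space_scale_ext scale_ext_def algebra_simps)
  show "fscale c F \<star> G = fscale c (F \<star> G)" "F \<star> fscale c G = fscale c (F \<star> G)"
    by (simp_all add: fun_eq_iff conv_def fscale_def sw_linear_comm[OF lin] algebra_simps)
qed

lemma fscale_minus_one: "fscale (- 1) F = - F"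
  by (auto simp: fscale_def)

lemma mul_diff: "(F - G) \<star> H = F \<star> H - G \<star> H" "F \<star> (G - H) = F \<star> G - F \<star> H"
proof -
  have eq: "A - B = A + fscale (- 1) B" for A B by (simp add: fscale_minus_one)
  show "(F - G) \<star> H = F \<star> H - G \<star> H" "F \<star> (G - H) = F \<star> G - F \<star> H"
    unfolding eq mul_add mul_scale by (rule refl)+
qed

lemma mul_zero: "0 \<star> F = 0" "F \<star> 0 = 0"
  using mul_diff[of F F F] mul_diff(2)[of F F F] mul_diff(1)[of 0 0 F] by simp_all

lemma unit_one: "unit 1 = 1"
  by (simp add: unit_def counit_one \<iota>_one)

primrec mpow :: "('h \<Rightarrow> 'e) \<Rightarrow> nat \<Rightarrow> 'h \<Rightarrow> 'e" where
  "mpow N 0 = unit"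
| "mpow N (Suc n) = mpow N n \<star> N"

lemma mpow_Func [simp]: "N \<in> Func \<Longrightarrow> mpow N n \<in> Func"
  by (induction n) auto

text \<open>\<open>filt\<close> is defined by functionals with values in k, so for values in the
  extension field the comultiplication is used: in N^(n+1) \<star> N the terms x \<otimes> 1 and 1
  \<otimes> x contribute zero because both factors vanish at 1, and the rest because N^(n+1)
  vanishes on \<open>filt n\<close>.\<close>

lemma mpow_vanishes:
  assumes N: "N \<in> Func" "N 1 = 0"
  shows "x \<in> filt n \<Longrightarrow> mpow N (Suc n) x = 0"
proof (induction n arbitrary: x)
  case 0
  then obtain c where "x = scale c 1" by (auto simp: filt_0 span_singleton)
  then show ?case using N by (simp add: mul_unit linear_scaleD[OF FuncD] scale_ext_def)
next
  case (Suc n)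
  obtain q where q: "Poly_Mapping.keys q \<subseteq> filt n \<times> filt n"
    and sw: "\<And>(t :: 'k \<Rightarrow> 'e \<Rightarrow> 'e) \<beta>. vector_space t \<Longrightarrow> bilinear scale t \<beta>
      \<Longrightarrow> sw t \<beta> x = \<beta> x 1 + \<beta> 1 x + lin_ext t (\<lambda>(a, b). \<beta> a b) q"
    using sw_filt[OF Suc.prems] by blast
  let ?M = "mpow N (Suc n)"
  have M: "?M \<in> Func" using N by (simp del: mpow.simps)
  have "mpow N (Suc (Suc n)) x = ?M x * N 1 + ?M 1 * N x + lin_ext scale_ext (\<lambda>(a, b). ?M a * N b) q"
    by (subst mpow.simps(2), subst conv_def, rule sw[OF vector_space_scale_ext Func_bilinear[OF M N(1)]])
  also have "lin_ext scale_ext (\<lambda>(a, b). ?M a * N b) q = 0"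
    unfolding lin_ext_def using q Suc.IH
    by (intro sum.neutral) (auto simp: scale_ext_def simp del: mpow.simps)
  also have "?M 1 = 0" by (rule Suc.IH) (rule one_in_filt)
  finally show ?case using N by simp
qed

text \<open>Up to the scalar G(1), G is \<open>unit - N\<close> with N vanishing at 1, hence
  nilpotent. The geometric series in N is finite and commutes with N, so it gives a two-sided
  inverse.\<close>

lemma Func_inverse:
  assumes G: "G \<in> Func" "G 1 \<noteq> 0"
  obtains G' where "G' \<in> Func" "G' \<star> G = unit" "G \<star> G' = unit"
proof -
  define N where "N = unit - fscale (inverse (G 1)) G"
  have N: "N \<in> Func" "N 1 = 0" using G by (simp_all add: N_def fscale_def unit_one)
  obtain m where m: "filt m = UNIV" using filt_exhausts by blast
  \<comment> \<open>The sum of the powers of \<open>N\<close> with exponents below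
    \<open>n\<close>.\<close>
  define gs where "gs n = (((\<lambda>Q. unit + Q \<star> N) ^^ n) 0)" for n
  have gs_Suc: "gs (Suc n) = unit + gs n \<star> N" for n by (simp add: gs_def)
  have gs_0: "gs 0 = 0" by (simp add: gs_def)
  have gs: "gs n \<in> Func" for n
    by (induction n) (simp_all only: gs_0 gs_Suc N Func_intros)
  have comm: "gs n \<star> N = N \<star> gs n" for n
  proof (induction n)
    case 0 then show ?case by (simp only: gs_0 mul_zero)
  next
    case (Suc n)
    have "gs (Suc n) \<star> N = N + gs n \<star> N \<star> N" by (simp add: gs_Suc mul_add mul_unit N)
    also have "\<dots> = N + N \<star> (gs n \<star> N)" using Suc by (simp add: mul_assoc N gs)
    also have "\<dots> = N \<star> gs (Suc n)" by (simp add: gs_Suc mul_add mul_unit N)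
    finally show ?case .
  qed
  have tele: "gs n - gs n \<star> N = unit - mpow N n" for n
  proof (induction n)
    case 0 then show ?case by (simp only: gs_0 mul_zero mpow.simps diff_self)
  next
    case (Suc n)
    have "gs (Suc n) - gs (Suc n) \<star> N = unit - N + (gs n - gs n \<star> N) \<star> N"
      by (simp add: gs_Suc mul_add mul_diff mul_unit N algebra_simps)
    also have "\<dots> = unit - mpow N (Suc n)"
      unfolding Suc by (simp add: mul_diff mul_unit N)
    finally show ?case .
  qed
  have "mpow N (Suc m) = 0"
    using mpow_vanishes[OF N, of _ m] m by (intro ext) (auto simp del: mpow.simps)
  with tele[of "Suc m"] have 1: "gs (Suc m) - gs (Suc m) \<star> N = unit" by simp
  let ?g = "gs (Suc m)"
  define c where "c = G 1"
  have G_eq: "fscale c (unit - N) = G" and c: "c \<noteq> 0"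
    using G by (auto simp: N_def fscale_def fun_eq_iff c_def)
  have g: "?g \<star> (unit - N) = unit" "(unit - N) \<star> ?g = unit"
    using 1 by (simp_all add: mul_diff mul_unit gs comm)
  have "fscale (inverse c) ?g \<star> fscale c (unit - N) = unit"
    "fscale c (unit - N) \<star> fscale (inverse c) ?g = unit"
    using c by (simp_all add: mul_scale g)
  then show ?thesis
    unfolding G_eq using gs by (intro that[of "fscale (inverse c) ?g"] Func_intros)
qed

end

section \<open>Derivations of the extended dual algebra and their diagonalizability\<close>

context scalar_extension
begin

text \<open>Linearity is required on \<open>Func\<close> only, because the function type also
  contains maps that are not linear over k.\<close>

definition lin_op :: "(('h \<Rightarrow> 'e) \<Rightarrow> ('h \<Rightarrow> 'e)) \<Rightarrow> bool" where
  "lin_op T \<longleftrightarrow> (\<forall>F\<in>Func. T F \<in> Func \<and> (\<forall>c. T (fscale c F) = fscale c (T F)) \<and>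
     (\<forall>G\<in>Func. T (F + G) = T F + T G))"

lemma lin_opD:
  assumes "lin_op T"
  shows "F \<in> Func \<Longrightarrow> T F \<in> Func" "F \<in> Func \<Longrightarrow> T (fscale c F) = fscale c (T F)"
    "F \<in> Func \<Longrightarrow> G \<in> Func \<Longrightarrow> T (F + G) = T F + T G"
  using assms by (auto simp: lin_op_def)

lemma lin_op_diff:
  assumes "lin_op T" "F \<in> Func" "G \<in> Func"
  shows "T (F - G) = T F - T G"
proof -
  have eq: "A - B = A + fscale (- 1) B" for A B by (simp add: fscale_minus_one)
  show ?thesis unfolding eq using assms by (simp only: lin_opD Func_intros)
qed

lemma lin_op_zero: "lin_op T \<Longrightarrow> T 0 = 0"
  using lin_op_diff[of T 0 0] by (simp only: Func_zero diff_self)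

definition op_poly :: "(('h \<Rightarrow> 'e) \<Rightarrow> ('h \<Rightarrow> 'e)) \<Rightarrow> 'e poly \<Rightarrow> ('h \<Rightarrow> 'e) \<Rightarrow> ('h \<Rightarrow> 'e)" where
  "op_poly D P F = polysum fscale P (\<lambda>i. (D ^^ i) F)"

lemma op_poly_pCons: "op_poly D (pCons c P) F = fscale c F + op_poly D P (D F)"
  unfolding op_poly_def FS.polysum_pCons by (simp only: funpow_Suc_right funpow_0 o_apply)

lemma op_poly_0: "op_poly D 0 F = 0"
  by (simp only: op_poly_def FS.polysum_0)

lemma lin_op_op_poly:
  assumes D: "lin_op D"
  shows "lin_op (op_poly D P)"
proof (induction P)
  case 0
  show ?case unfolding lin_op_def by (auto simp only: op_poly_0 Func_intros FS.scale_zero_right add_0)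
next
  case (pCons c P)
  show ?case
    unfolding lin_op_def op_poly_pCons
  proof (intro ballI conjI allI)
    fix F d assume F: "F \<in> Func"
    note DF = lin_opD(1)[OF D F]
    show "fscale c F + op_poly D P (D F) \<in> Func"
      by (intro Func_intros F DF lin_opD[OF pCons.IH])
    show "fscale c (fscale d F) + op_poly D P (D (fscale d F)) = fscale d (fscale c F + op_poly D P (D F))"
      by (simp only: lin_opD(2)[OF D F] lin_opD(2)[OF pCons.IH DF] FS.scale_right_distrib FS.scale_scale mult.commute)
    fix G assume G: "G \<in> Func"
    show "fscale c (F + G) + op_poly D P (D (F + G)) = fscale c F + op_poly D P (D F) + (fscale c G + op_poly D P (D G))"
      by (simp only: lin_opD(3)[OF D F G] lin_opD(3)[OF pCons.IH DF lin_opD(1)[OF D G]]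
          FS.scale_right_distrib add_ac)
  qed
qed

lemma op_poly_commute:
  assumes D: "lin_op D" and T: "lin_op T" and comm: "\<And>F. F \<in> Func \<Longrightarrow> T (D F) = D (T F)"
  shows "F \<in> Func \<Longrightarrow> T (op_poly D P F) = op_poly D P (T F)"
proof (induction P arbitrary: F)
  case 0
  show ?case by (simp only: op_poly_0 lin_op_zero[OF T])
next
  case (pCons c P)
  then show ?case
    by (simp only: op_poly_pCons lin_opD[OF D] lin_opD[OF T] lin_opD[OF lin_op_op_poly[OF D]] Func_intros comm)
qed

lemma op_poly_linear_factor:
  assumes D: "lin_op D" and F: "F \<in> Func"
  shows "op_poly D ([:- \<mu>, 1:] * P) F = op_poly D P (D F - fscale \<mu> F)"
    and "op_poly D ([:- \<mu>, 1:] * P) F = D (op_poly D P F) - fscale \<mu> (op_poly D P F)"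
proof -
  have "op_poly D ([:- \<mu>, 1:] * P) F = op_poly D P (D F) - fscale \<mu> (op_poly D P F)"
    unfolding op_poly_def FS.polysum_linear_factor by (simp only: funpow_Suc_right o_apply)
  moreover have "op_poly D P (D F) = D (op_poly D P F)"
    by (rule op_poly_commute[OF D D refl F, symmetric])
  moreover have "op_poly D P (D F - fscale \<mu> F) = op_poly D P (D F) - fscale \<mu> (op_poly D P F)"
    using lin_op_op_poly[OF D] by (simp only: lin_op_diff lin_opD D F Func_intros)
  ultimately show "op_poly D ([:- \<mu>, 1:] * P) F = op_poly D P (D F - fscale \<mu> F)"
    "op_poly D ([:- \<mu>, 1:] * P) F = D (op_poly D P F) - fscale \<mu> (op_poly D P F)" by simp_all
qed

lemma op_poly_eigen: "D F = fscale \<mu> F \<Longrightarrow> lin_op D \<Longrightarrow> F \<in> Func \<Longrightarrow> op_poly D P F = fscale (poly P \<mu>) F"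
proof (induction P)
  case 0
  show ?case by (simp only: op_poly_0 poly_0 FS.scale_zero_left)
next
  case (pCons c P)
  then show ?case
    by (simp only: op_poly_pCons lin_opD[OF lin_op_op_poly] poly_pCons FS.scale_left_distrib FS.scale_scale mult.commute)
qed

lemma sum_fun_apply: "(\<Sum>i\<in>I. f i :: 'h \<Rightarrow> 'e) x = (\<Sum>i\<in>I. f i x)"
  by (induction I rule: infinite_finite_induct) auto

lemma Func_sum: "(\<And>i. i \<in> I \<Longrightarrow> f i \<in> Func) \<Longrightarrow> (\<Sum>i\<in>I. f i) \<in> Func"
  by (induction I rule: infinite_finite_induct) (simp_all only: sum.infinite sum.empty sum.insert Func_intros insertI1 insertI2 simp_thms)

lemma mul_sum: "(\<Sum>i\<in>I. f i) \<star> G = (\<Sum>i\<in>I. f i \<star> G)" "G \<star> (\<Sum>i\<in>I. f i) = (\<Sum>i\<in>I. G \<star> f i)"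
  by (induction I rule: infinite_finite_induct) (simp_all only: sum.infinite sum.empty sum.insert mul_zero mul_add simp_thms)

lemma Func_finite_span: "\<exists>B. finite B \<and> Func \<subseteq> FS.span B"
proof -
  let ?r = "\<lambda>b x. \<iota> (representation Basis x b)"
  have "F \<in> FS.span (?r ` Basis)" if F: "F \<in> Func" for F
  proof -
    have "F x = (\<Sum>b\<in>Basis. fscale (F b) (?r b)) x" for x
    proof -
      have "F x = F (\<Sum>b\<in>Basis. scale (representation Basis x b) b)"
        using independent_Basis span_Basis finite_Basis by (subst sum_representation_eq) auto
      also have "\<dots> = (\<Sum>b\<in>Basis. fscale (F b) (?r b) x)"
        using F by (simp add: linear_sumD[OF FuncD] linear_scaleD[OF FuncD] scale_ext_def fscale_def mult.commute)
      also have "\<dots> = (\<Sum>b\<in>Basis. fscale (F b) (?r b)) x"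
        by (rule sum_fun_apply[symmetric])
      finally show ?thesis .
    qed
    then have "F = (\<Sum>b\<in>Basis. fscale (F b) (?r b))" by blast
    also have "\<dots> \<in> FS.span (?r ` Basis)"
      by (intro FS.span_sum FS.span_scale FS.span_base) auto
    finally show ?thesis .
  qed
  then show ?thesis using finite_Basis by blast
qed

text \<open>Besides the Leibniz rule this records vanishing at \<Lambda>, which keeps the unit out
  of the image, and compatibility with right translations, which allows any point to be moved to
  1.\<close>

definition derivation :: "(('h \<Rightarrow> 'e) \<Rightarrow> ('h \<Rightarrow> 'e)) \<Rightarrow> bool" where
  "derivation D \<longleftrightarrow> lin_op D \<and> (\<forall>F\<in>Func. D F \<Lambda> = 0 \<and>
     (\<forall>G\<in>Func. D (F \<star> G) = D F \<star> G + F \<star> D G) \<and> (\<forall>a. D (\<lambda>x. F (x * a)) = (\<lambda>x. D F (x * a))))"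

lemma derivationD:
  assumes "derivation D"
  shows "lin_op D" "F \<in> Func \<Longrightarrow> D F \<Lambda> = 0"
    "F \<in> Func \<Longrightarrow> G \<in> Func \<Longrightarrow> D (F \<star> G) = D F \<star> G + F \<star> D G"
    "F \<in> Func \<Longrightarrow> D (\<lambda>x. F (x * a)) = (\<lambda>x. D F (x * a))"
  using assms by (auto simp: derivation_def)

lemma derivation_unit:
  assumes D: "derivation D"
  shows "D unit = 0"
proof -
  have "D unit = D unit + D unit"
    using derivationD(3)[OF D Func_unit Func_unit]
    by (simp only: mul_unit Func_unit lin_opD[OF derivationD(1)[OF D]])
  then have "D unit + 0 = D unit + D unit" by simp
  then show ?thesis by (simp only: add_left_cancel)
qed

text \<open>Otherwise \<open>D F - \<mu> F\<close> has an inverse \<open>K\<close>, and \<open>D (K \<star> F)\<close> is the unit.\<close>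

lemma derivation_eigenvector_at_one:
  assumes D: "derivation D" and F: "F \<in> Func"
    and eig: "D (D F - fscale \<mu> F) = fscale \<mu> (D F - fscale \<mu> F)"
  shows "(D F - fscale \<mu> F) 1 = 0"
proof (rule ccontr)
  define H where "H = D F - fscale \<mu> F"
  assume nz: "(D F - fscale \<mu> F) 1 \<noteq> 0"
  note lin = lin_opD[OF derivationD(1)[OF D]]
  have H: "H \<in> Func" unfolding H_def by (intro Func_intros lin F)
  obtain K where K: "K \<in> Func" "K \<star> H = unit" "H \<star> K = unit"
    using Func_inverse[OF H] nz unfolding H_def by blast
  have DH: "D H = fscale \<mu> H" using eig unfolding H_def .
  \<comment> \<open>Obtained by differentiating \<open>K \<star> H = unit\<close>. The opposite
    eigenvalues of \<open>K\<close> and \<open>H\<close> then cancel in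
    \<open>D (K \<star> F)\<close>.\<close>
  have DK: "D K = fscale (- \<mu>) K"
  proof -
    have "D (K \<star> H) = D K \<star> H + fscale \<mu> unit"
      by (subst derivationD(3)[OF D K(1) H]) (simp only: DH mul_scale K(2))
    then have "D K \<star> H + fscale \<mu> unit = 0" unfolding K(2) derivation_unit[OF D] by simp
    then have "D K \<star> H = fscale (- \<mu>) unit"
      by (simp only: FS.scale_minus_left eq_neg_iff_add_eq_0)
    then have "D K \<star> H \<star> K = fscale (- \<mu>) K" by (simp only: mul_scale mul_unit K(1))
    then show ?thesis using K H by (simp only: mul_assoc lin mul_unit)
  qed
  have DF: "D F = fscale \<mu> F + H" unfolding H_def by simp
  have "D (K \<star> F) = fscale (- \<mu>) (K \<star> F) + (fscale \<mu> (K \<star> F) + unit)"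
    by (simp only: derivationD(3)[OF D K(1) F] DK DF mul_scale mul_add K(2))
  also have "\<dots> = unit" by (simp only: FS.scale_minus_left minus_add_cancel)
  finally have "unit \<Lambda> = 0" using derivationD(2)[OF D Func_mul[OF K(1) F]] by simp
  then show False by (simp add: unit_def counit_integral \<iota>_one)
qed

text \<open>The translate of F by a satisfies the same equation, and the value at 1 of the translate
  of D F - \<mu> F is the value of D F - \<mu> F at a.\<close>

lemma derivation_semisimple:
  assumes D: "derivation D" and F: "F \<in> Func"
    and eig: "D (D F - fscale \<mu> F) = fscale \<mu> (D F - fscale \<mu> F)"
  shows "D F = fscale \<mu> F"
proof
  fix a
  note lin = lin_opD[OF derivationD(1)[OF D]]
  let ?F = "\<lambda>x. F (x * a)" and ?H = "D F - fscale \<mu> F"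
  have H: "?H \<in> Func" by (intro Func_intros lin F)
  have DF: "D ?F - fscale \<mu> ?F = (\<lambda>x. ?H (x * a))"
    unfolding derivationD(4)[OF D F] by (auto simp: fscale_def)
  have "D (D ?F - fscale \<mu> ?F) = (\<lambda>x. D ?H (x * a))"
    unfolding DF by (rule derivationD(4)[OF D H])
  also have "\<dots> = fscale \<mu> (\<lambda>x. ?H (x * a))"
    unfolding eig by (auto simp: fscale_def)
  finally have "D (D ?F - fscale \<mu> ?F) = fscale \<mu> (D ?F - fscale \<mu> ?F)" unfolding DF .
  then have "(D ?F - fscale \<mu> ?F) 1 = 0"
    by (rule derivation_eigenvector_at_one[OF D Func_right[OF F]])
  then show "D F a = fscale \<mu> F a" unfolding DF by simp
qed

text \<open>
  \<open>D\<close> is diagonalizable; on an eigenvector \<open>F\<close> for \<open>\<mu>\<close>, the operator \<open>(D - \<mu>)\<^sup>2\<close> kills \<open>U F\<close>, hence so does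
  \<open>D - \<mu>\<close>, which maps \<open>U F\<close> to \<open>[D, U] F\<close>.
\<close>

lemma derivation_commutator:
  assumes D: "derivation D" and U: "lin_op U"
    and comm: "\<And>F. F \<in> Func \<Longrightarrow> D (D (U F) - U (D F)) = D (U (D F)) - U (D (D F))"
    and F: "F \<in> Func"
  shows "D (U F) = U (D F)"
proof -
  define C where "C F = D (U F) - U (D F)" for F
  note Dl = derivationD(1)[OF D]
  note lin = lin_opD[OF Dl] and linU = lin_opD[OF U]
  have C: "lin_op C"
    unfolding lin_op_def C_def
    by (simp add: lin linU FS.scale_right_diff_distrib algebra_simps del: plus_fun_apply minus_apply)
  note linC = lin_opD[OF C]
  have DC: "C (D F) = D (C F)" if "F \<in> Func" for F
    unfolding C_def comm[OF that] ..
  have eigen: "C F = 0" if F: "F \<in> Func" and DF: "D F = fscale \<mu> F" for F \<mu>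
  proof -
    have eq: "D (U F) - fscale \<mu> (U F) = C F"
      unfolding C_def DF linU(2)[OF F] ..
    have "D (C F) = fscale \<mu> (C F)"
      using DC[OF F] unfolding DF linC(2)[OF F] by simp
    then have "D (U F) = fscale \<mu> (U F)"
      by (intro derivation_semisimple[OF D linU(1)[OF F]]) (simp only: eq)
    then show ?thesis using eq by simp
  qed
  \<comment> \<open>Induction on the degree of a polynomial in \<open>D\<close> that annihilates
    \<open>F\<close>, splitting off one root \<mu> at a time.\<close>
  have main: "C F = 0" if "P \<noteq> 0" "F \<in> Func" "op_poly D P F = 0" for P F
    using that
  proof (induction "degree P" arbitrary: P F rule: less_induct)
    case less
    note F = \<open>F \<in> Func\<close>
    show ?case
    proof (cases "degree P = 0")
      case True
      then obtain c where "P = [:c:]" by (rule degree_eq_zeroE)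
      with less.prems have "fscale c F = 0" "c \<noteq> 0"
        by (auto simp only: op_poly_pCons op_poly_0 add_0_right pCons_0_0)
      then have "F = 0" by (simp only: FS.scale_eq_0_iff simp_thms)
      then show ?thesis by (simp only: lin_op_zero[OF C])
    next
      case False
      then obtain \<mu> where "poly P \<mu> = 0" using alg_closed_imp_poly_has_root[of P] by auto
      then obtain Q where P: "P = [:- \<mu>, 1:] * Q" unfolding poly_eq_0_iff_dvd by (auto elim: dvdE)
      then have Q: "Q \<noteq> 0" using less.prems by auto
      then have deg: "degree Q < degree P"
        unfolding P by (subst degree_mult_eq) auto
      let ?G = "op_poly D Q F"
      have G: "?G \<in> Func" by (rule lin_opD(1)[OF lin_op_op_poly[OF Dl] F])
      show ?thesis
      proof (cases "poly Q \<mu> = 0")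
        \<comment> \<open>For a double root, the square of D - \<mu> kills
          \<open>op_poly D R F\<close>, hence so does D - \<mu>, and the smaller polynomial
          \<open>Q\<close> already annihilates \<open>F\<close>.\<close>
        case True
        then obtain R where R: "Q = [:- \<mu>, 1:] * R" unfolding poly_eq_0_iff_dvd by (auto elim: dvdE)
        let ?H = "op_poly D R F"
        have H: "?H \<in> Func" by (rule lin_opD(1)[OF lin_op_op_poly[OF Dl] F])
        have GH: "?G = D ?H - fscale \<mu> ?H"
          unfolding R by (rule op_poly_linear_factor(2)[OF Dl F])
        have "D ?G - fscale \<mu> ?G = 0"
          using less.prems(3) unfolding P op_poly_linear_factor(2)[OF Dl F] .
        then have "D ?H = fscale \<mu> ?H"
          using derivation_semisimple[OF D H, of \<mu>] unfolding GH by simp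
        then have "?G = 0" unfolding GH by simp
        then show ?thesis by (rule less.hyps[OF deg Q F])
      next
        case False
        \<comment> \<open>For a simple root, the induction hypothesis for \<open>?K\<close> makes
          \<open>C F\<close> an eigenvector for \<mu>. Since C commutes with D, C sends
          \<open>?G\<close> to the nonzero multiple \<open>poly Q \<mu>\<close> of
          \<open>C F\<close>; but \<open>?G\<close> is itself an eigenvector, so C kills it.\<close>
        let ?K = "D F - fscale \<mu> F"
        have K: "?K \<in> Func" by (intro Func_intros lin F)
        have "op_poly D Q ?K = 0"
          using less.prems(3) unfolding P op_poly_linear_factor(1)[OF Dl F] .
        then have "C ?K = 0" by (rule less.hyps[OF deg Q K])
        then have "C (D F) - fscale \<mu> (C F) = 0"
          using F by (simp only: lin_op_diff[OF C] lin linC Func_intros)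
        then have eig: "D (C F) = fscale \<mu> (C F)" unfolding DC[OF F] by simp
        have "D ?G - fscale \<mu> ?G = 0"
          using less.prems(3) unfolding P op_poly_linear_factor(2)[OF Dl F] .
        then have "C ?G = 0" by (intro eigen[OF G, of \<mu>]) simp
        moreover have "C ?G = op_poly D Q (C F)" by (rule op_poly_commute[OF Dl C DC F])
        moreover have "\<dots> = fscale (poly Q \<mu>) (C F)" by (rule op_poly_eigen[OF eig Dl linC(1)[OF F]])
        ultimately have "fscale (poly Q \<mu>) (C F) = 0" by simp
        with False show ?thesis by (simp only: FS.scale_eq_0_iff simp_thms)
      qed
    qed
  qed
  obtain B where "finite B" "Func \<subseteq> FS.span B" using Func_finite_span by blast
  moreover have "(D ^^ i) F \<in> Func" for i
    by (induction i) (simp_all add: F lin)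
  ultimately obtain P where "P \<noteq> 0" "polysum fscale P (\<lambda>i. (D ^^ i) F) = 0"
    using FS.exists_annihilating_poly[of B "\<lambda>i. (D ^^ i) F"] by blast
  then have "C F = 0" using F unfolding op_poly_def[symmetric] by (intro main)
  then show ?thesis unfolding C_def by simp
qed

text \<open>Left multiplication by the element \<open>\<Sum> e\<^sub>i \<otimes> x\<^sub>i\<close> of the extension of \<open>H\<close>.\<close>

definition act :: "nat \<Rightarrow> (nat \<Rightarrow> 'e) \<Rightarrow> (nat \<Rightarrow> 'h) \<Rightarrow> ('h \<Rightarrow> 'e) \<Rightarrow> 'h \<Rightarrow> 'e" where
  "act n e x F = (\<Sum>i\<le>n. fscale (e i) (\<lambda>a. F (x i * a)))"

lemma act_apply: "act n e x F a = (\<Sum>i\<le>n. e i * F (x i * a))"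
  by (simp only: act_def sum_fun_apply fscale_def)

lemma lin_op_act: "lin_op (act n e x)"
proof -
  have "act n e x F \<in> Func" if "F \<in> Func" for F
    unfolding act_def using that by (intro Func_sum Func_intros)
  moreover have "act n e x (fscale c F) = fscale c (act n e x F)"
    "act n e x (F + G) = act n e x F + act n e x G" for c F G
    by (auto simp: fun_eq_iff act_apply fscale_def algebra_simps sum_distrib_left sum.distrib)
  ultimately show ?thesis unfolding lin_op_def by blast
qed

lemma primitive_left_mult:
  assumes x: "primitive x" and F: "F \<in> Func" and G: "G \<in> Func"
  shows "(\<lambda>a. (F \<star> G) (x * a)) = (\<lambda>b. F (x * b)) \<star> G + F \<star> (\<lambda>b. G (x * b))"
proof
  fix a
  have "(F \<star> G) (x * a) = sw scale_ext (\<lambda>b c. sw scale_ext (\<lambda>u v. F (b * u) * G (c * v)) a) x"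
    unfolding conv_def by (rule sw_mult[OF vector_space_scale_ext Func_bilinear[OF F G]])
  also have "\<dots> = sw scale_ext (\<lambda>u v. F (x * u) * G v) a + sw scale_ext (\<lambda>u v. F u * G (x * v)) a"
  proof (subst sw_primitive[OF x vector_space_scale_ext])
    show "bilinear scale scale_ext (\<lambda>b c. sw scale_ext (\<lambda>u v. F (b * u) * G (c * v)) a)"
      using FuncD[OF Func_right[OF F]] FuncD[OF Func_right[OF G]]
      by (intro bilinearI linear_sw_param vector_space_axioms vector_space_scale_ext algebra_over_field.linear_mult_left[OF algebra_scale_ext]
          algebra_over_field.linear_mult_right[OF algebra_scale_ext])
  qed simp
  finally show "(F \<star> G) (x * a) = ((\<lambda>b. F (x * b)) \<star> G + F \<star> (\<lambda>b. G (x * b))) a"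
    by (simp add: conv_def)
qed

text \<open>The Leibniz rule is primitivity, translations commute with the action because left and
  right multiplications do, and F(x_i \<Lambda>) vanishes because x_i \<Lambda> = \<epsilon>(x_i)
  \<Lambda> = 0.\<close>

lemma derivation_act:
  assumes x: "\<And>i. primitive (x i)"
  shows "derivation (act n e x)"
  unfolding derivation_def
proof (intro conjI ballI allI lin_op_act)
  fix F assume F: "F \<in> Func"
  show "act n e x F \<Lambda> = 0"
    using counit_primitive[OF x] linear_zeroD[OF FuncD[OF F]] by (simp add: act_apply integral)
  show "act n e x (\<lambda>x. F (x * a)) = (\<lambda>b. act n e x F (b * a))" for a
    by (simp add: fun_eq_iff act_apply mult.assoc)
  fix G assume G: "G \<in> Func"
  show "act n e x (F \<star> G) = act n e x F \<star> G + F \<star> act n e x G"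
    by (simp only: act_def primitive_left_mult[OF x F G] mul_sum mul_scale FS.scale_right_distrib sum.distrib)
qed

end

section \<open>Primitive elements and commutators\<close>

context connected_bialgebra
begin

text \<open>If all products of functionals agree on two tensors, then every slice of the difference
  is zero. A tensor with slices in {0} has a representative with entries in {0}, hence is
  zero.\<close>

lemma tensor2_eqI:
  assumes "\<And>F G. functional F \<Longrightarrow> functional G \<Longrightarrow>
    lin_ext (*) (\<lambda>(a, b). F a * G b) p = lin_ext (*) (\<lambda>(a, b). F a * G b) q"
  shows "tensor2_eq scale p q"
proof -
  have eq: "lin_ext (*) (\<lambda>(a, b). F a * G b) (p - q) = 0" if "functional F" "functional G" for F G
    using assms[OF that] by (simp add: lin_ext_diff vector_space_mult)
  have "lin_ext scale (\<lambda>(a, b). scale (F b) a) (p - q) \<in> {0}" if F: "functional F" for F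
  proof -
    have "lin_ext scale (\<lambda>(a, b). scale (F b) a) (p - q) = 0"
    proof (rule functional_eqI)
      fix G assume G: "functional G"
      show "G (lin_ext scale (\<lambda>(a, b). scale (F b) a) (p - q)) = G 0"
        using eq[OF G F]
        by (simp add: linear_lin_ext_comm[OF G] linear_zeroD[OF G] case_prod_unfold linear_scaleD[OF G] mult.commute)
    qed
    then show ?thesis by simp
  qed
  moreover have "lin_ext scale (\<lambda>(a, b). scale (F a) b) (p - q) \<in> {0}" if F: "functional F" for F
  proof -
    have "lin_ext scale (\<lambda>(a, b). scale (F a) b) (p - q) = 0"
    proof (rule functional_eqI)
      fix G assume G: "functional G"
      show "G (lin_ext scale (\<lambda>(a, b). scale (F a) b) (p - q)) = G 0"
        using eq[OF F G]
        by (simp add: linear_lin_ext_comm[OF G] linear_zeroD[OF G] case_prod_unfold linear_scaleD[OF G])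
    qed
    then show ?thesis by simp
  qed
  ultimately obtain r where r: "Poly_Mapping.keys r \<subseteq> {0} \<times> {0}" "tensor2_eq scale (p - q) r"
    by (rule tensor2_in_subspace[OF subspace_single_0])
  have "tensor2_eq scale r 0"
  proof -
    have "tensor2_eq scale (\<Sum>k\<in>Poly_Mapping.keys r. free_scale (Poly_Mapping.lookup r k) (free_gen k))
      (\<Sum>k\<in>Poly_Mapping.keys r. free_scale (Poly_Mapping.lookup r k) 0)"
      using r(1) by (intro tensor2_eq_sum tensor2_eq_scale) (auto simp: tensor2_gen_zero)
    moreover have "free_scale c 0 = (0 :: ('h \<times> 'h) \<Rightarrow>\<^sub>0 'k)" for c
      by (rule poly_mapping_eqI) simp
    ultimately show ?thesis unfolding free_gen_expansion[symmetric] by simp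
  qed
  with r(2) have "tensor2_eq scale (p - q) 0" by (rule tensor2_eq_trans)
  then show ?thesis by (simp add: tensor2_eq_def)
qed

end

context integral_bialgebra
begin

lemma primitiveI:
  assumes "\<And>F G. functional F \<Longrightarrow> functional G \<Longrightarrow> convk F G x = F x * G 1 + F 1 * G x"
  shows "primitive x"
  unfolding primitive_def
proof (rule tensor2_eqI)
  fix F G assume "functional F" "functional G"
  from assms[OF this]
  show "lin_ext (*) (\<lambda>(a, b). F a * G b) (\<Delta> x) =
      lin_ext (*) (\<lambda>(a, b). F a * G b) (free_gen (x, 1) + free_gen (1, x))"
    by (simp add: conv_def sw_def lin_ext_add vector_space_mult)
qed

lemma primitive_in_filt:
  assumes x: "primitive x"
  shows "x \<in> filt (Suc 0)"
proof -
  have "F x = 0" if "F \<in> aug_words (Suc (Suc 0))" for F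
  proof -
    from that obtain G H where F: "F = convk G (convk H \<epsilon>)" "aug G" "aug H" by auto
    then have "F x = convk G H x" by (simp add: convk_counit augD)
    also have "\<dots> = G x * H 1 + G 1 * H x"
      unfolding conv_def using F
      by (intro sw_primitive x vector_space_mult algebra_over_field.bilinear_mult algebra_mult augD)
    finally show ?thesis using F by (simp add: augD)
  qed
  then show ?thesis unfolding filt_def by blast
qed

lemma filt_0_commute: "a \<in> filt 0 \<Longrightarrow> a * b = b * a"
  by (auto simp: filt_0 span_singleton scale_mult_left scale_mult_right)

text \<open>Expand [\<Delta> x, \<Delta> y] with \<Delta> x = x \<otimes> 1 + 1 \<otimes> x + q and
  \<Delta> y = y \<otimes> 1 + 1 \<otimes> y + r. The commutation hypotheses remove every term that
  involves q or r, and [x,y] \<otimes> 1 + 1 \<otimes> [x,y] is left.\<close>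

lemma primitive_commutator:
  assumes x: "x \<in> filt (Suc m)" and y: "y \<in> filt (Suc n)"
    and ab: "\<And>a b. a \<in> filt m \<Longrightarrow> b \<in> filt n \<Longrightarrow> a * b = b * a"
    and ay: "\<And>a. a \<in> filt m \<Longrightarrow> a * y = y * a"
    and xb: "\<And>b. b \<in> filt n \<Longrightarrow> x * b = b * x"
  shows "primitive (x * y - y * x)"
proof (rule primitiveI)
  fix F G assume F: "functional F" and G: "functional G"
  note lin = linear_intros F G algebra_mult vector_space_mult algebra_over_field_axioms
    linear_compose[OF F] linear_compose[OF G]
  \<comment> \<open>The value of F \<otimes> G on the commutator of a \<otimes> b with c \<otimes>
    d.\<close>
  define \<gamma> where "\<gamma> a b c d = F (a * c) * G (b * d) - F (c * a) * G (d * b)" for a b c d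
  define \<beta> where "\<beta> a b = sw (*) (\<gamma> a b) y" for a b
  have bil_\<gamma>: "bilinear scale (*) (\<gamma> a b)" for a b
    unfolding \<gamma>_def by (intro bilinearI lin vector_space_axioms)
  have bil_\<beta>: "bilinear scale (*) \<beta>"
    unfolding \<beta>_def \<gamma>_def by (intro bilinearI lin vector_space_axioms)
  have bilFG: "bilinear scale (*) (\<lambda>a b. F a * G b)"
    by (intro bilinearI lin vector_space_axioms)
  obtain q where q: "Poly_Mapping.keys q \<subseteq> filt m \<times> filt m"
    and swx: "\<And>(t :: 'k \<Rightarrow> 'k \<Rightarrow> 'k) \<beta>. vector_space t \<Longrightarrow> bilinear scale t \<beta>
      \<Longrightarrow> sw t \<beta> x = \<beta> x 1 + \<beta> 1 x + lin_ext t (\<lambda>(a, b). \<beta> a b) q"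
    using sw_filt[OF x] by blast
  obtain r where r: "Poly_Mapping.keys r \<subseteq> filt n \<times> filt n"
    and swy: "\<And>(t :: 'k \<Rightarrow> 'k \<Rightarrow> 'k) \<beta>. vector_space t \<Longrightarrow> bilinear scale t \<beta>
      \<Longrightarrow> sw t \<beta> y = \<beta> y 1 + \<beta> 1 y + lin_ext t (\<lambda>(a, b). \<beta> a b) r"
    using sw_filt[OF y] by blast
  have \<beta>: "\<beta> a b = \<gamma> a b y 1 + \<gamma> a b 1 y + lin_ext (*) (\<lambda>(c, d). \<gamma> a b c d) r" for a b
    unfolding \<beta>_def by (rule swy[OF vector_space_mult bil_\<gamma>])
  have zero: "lin_ext (*) (\<lambda>(c, d). f c d) p = 0"
    if "Poly_Mapping.keys p \<subseteq> A \<times> A" "\<And>c d. c \<in> A \<Longrightarrow> d \<in> A \<Longrightarrow> f c d = 0" for f p and A :: "'h set"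
    unfolding lin_ext_def using that by (intro sum.neutral) auto
  have "\<beta> x 1 = F (x * y - y * x) * G 1"
    unfolding \<beta> by (subst zero[OF r]) (auto simp: \<gamma>_def xb linear_diffD[OF F] algebra_simps)
  moreover have "\<beta> 1 x = F 1 * G (x * y - y * x)"
    unfolding \<beta> by (subst zero[OF r]) (auto simp: \<gamma>_def xb linear_diffD[OF G] algebra_simps)
  moreover have "lin_ext (*) (\<lambda>(a, b). \<beta> a b) q = 0"
  proof (rule zero[OF q])
    fix a b assume "a \<in> filt m" "b \<in> filt m"
    then show "\<beta> a b = 0"
      unfolding \<beta> by (subst zero[OF r]) (auto simp: \<gamma>_def ay ab)
  qed
  moreover have "convk F G (x * y - y * x) = sw (*) \<beta> x"
  proof -
    have "convk F G (x * y - y * x) = convk F G (x * y) - convk F G (y * x)"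
      by (rule linear_diffD[OF functional_conv[OF F G]])
    also have "convk F G (x * y) = sw (*) (\<lambda>a b. sw (*) (\<lambda>c d. F (a * c) * G (b * d)) y) x"
      unfolding conv_def by (rule sw_mult[OF vector_space_mult bilFG])
    also have "convk F G (y * x) = sw (*) (\<lambda>c d. sw (*) (\<lambda>a b. F (c * a) * G (d * b)) x) y"
      unfolding conv_def by (rule sw_mult[OF vector_space_mult bilFG])
    also have "\<dots> = sw (*) (\<lambda>a b. sw (*) (\<lambda>c d. F (c * a) * G (d * b)) y) x"
      by (rule sw_swap[OF vector_space_mult])
    finally show ?thesis
      unfolding \<beta>_def \<gamma>_def by (simp add: sw_def lin_ext_def case_prod_unfold sum_subtractf algebra_simps)
  qed
  ultimately show "convk F G (x * y - y * x) = F (x * y - y * x) * G 1 + F 1 * G (x * y - y * x)"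
    using swx[OF vector_space_mult bil_\<beta>] by simp
qed

lemma primitive_commutator_primitive:
  "primitive x \<Longrightarrow> primitive y \<Longrightarrow> primitive (x * y - y * x)"
  by (rule primitive_commutator[OF primitive_in_filt primitive_in_filt
        filt_0_commute filt_0_commute filt_0_commute[symmetric]])

end

section \<open>Centrality of the primitive elements\<close>

context scalar_extension
begin

lemma Func_separates:
  assumes "\<And>F. F \<in> Func \<Longrightarrow> F x = F y"
  shows "x = y"
proof (rule functional_eqI)
  fix f assume f: "functional f"
  have "(\<lambda>x. \<iota> (f x)) \<in> Func"
    unfolding Func_def by (auto intro!: linearI vector_space_axioms vector_space_scale_ext simp: linear_addD[OF f] linear_scaleD[OF f] \<iota>_add \<iota>_mult scale_ext_def)
  from assms[OF this] have "\<iota> (f x - f y) = 0"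
    using \<iota>_add[of "f x - f y" "f y"] by simp
  then show "f x = f y" by simp
qed

text \<open>The hypothesis says that the square of ad t kills u, and the conclusion that ad t
  already does: diagonalizability of t, transported from operators on functionals to H.\<close>

lemma ad_primitive_semisimple:
  assumes t: "primitive t" and comm: "t * (u * t - t * u) = (u * t - t * u) * t"
  shows "u * t = t * u"
proof (rule Func_separates)
  fix F assume F: "F \<in> Func"
  \<comment> \<open>Passing to functionals reverses products: \<open>mult t (mult u F)\<close> has
    the value \<open>F (u * t * a)\<close> at \<open>a\<close>.\<close>
  define mult where "mult x = act 0 (\<lambda>_. 1) (\<lambda>_. x)" for x
  have mult: "mult x F a = F (x * a)" for x F a by (simp add: mult_def act_apply)
  have "mult t (mult u F) = mult u (mult t F)"
  proof (rule derivation_commutator)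
    show "derivation (mult t)" unfolding mult_def by (intro derivation_act t)
    show "lin_op (mult u)" unfolding mult_def by (rule lin_op_act)
    fix F assume F: "F \<in> Func"
    have "mult t (mult t (mult u F) - mult u (mult t F)) a = mult t (mult u (mult t F)) a - mult u (mult t (mult t F)) a" for a
    proof -
      have "F (u * t * (t * a)) - F (t * u * (t * a)) = F ((u * t - t * u) * t * a)"
        using linear_diffD[OF FuncD[OF F]] by (simp add: algebra_simps)
      also have "\<dots> = F (t * (u * t - t * u) * a)" unfolding comm ..
      also have "\<dots> = F (t * (u * t) * a) - F (t * (t * u) * a)"
        using linear_diffD[OF FuncD[OF F]] by (simp add: algebra_simps)
      finally show ?thesis by (simp add: mult mult.assoc)
    qed
    then show "mult t (mult t (mult u F) - mult u (mult t F)) = mult t (mult u (mult t F)) - mult u (mult t (mult t F))"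
      by (simp add: fun_eq_iff)
  qed (rule F)
  then have "mult t (mult u F) 1 = mult u (mult t F) 1" by simp
  then show "F (u * t) = F (t * u)" by (simp add: mult)
qed

text \<open>
  With \<open>w\<^sub>i = ad(y)\<^sup>i(x)\<close>, the operator \<open>opr P\<close> is left multiplication by \<open>P(ad y)(x)\<close>, for a polynomial \<open>P\<close>
  over the extension field.  If it vanishes for \<open>(t - \<mu>) P\<close>, then \<open>P(ad y)(x)\<close> is an eigenvector of
  \<open>ad y\<close>; it commutes with its own commutator with \<open>y\<close>, which is therefore zero.  In this way all
  linear factors of an annihilating polynomial are replaced by \<open>t\<close>.
\<close>

lemma primitives_commute:
  assumes x: "primitive x" and y: "primitive y"
  shows "x * y = y * x"
proof -
  define w where "w i = ((\<lambda>v. y * v - v * y) ^^ i) x" for i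
  have w_Suc: "w (Suc i) = y * w i - w i * y" for i by (simp add: w_def)
  have w: "primitive (w i)" for i
    by (induction i) (auto simp: w_def x y primitive_commutator_primitive)
  define opr where "opr P F = polysum fscale P (\<lambda>i a. F (w i * a))" for P F
  have opr_act: "opr P = act (degree P) (coeff P) w" for P
    by (simp add: fun_eq_iff opr_def act_def polysum_def)
  have step: "opr (pCons 0 P) F = 0"
    if ann: "\<And>F. F \<in> Func \<Longrightarrow> opr ([:- \<mu>, 1:] * P) F = 0" and F: "F \<in> Func" for P \<mu> F
  proof -
    define U where "U = act 0 (\<lambda>_. 1) (\<lambda>_. y)"
    have U: "U F a = F (y * a)" for F a by (simp add: U_def act_apply)
    let ?D = "opr P"
    have D: "derivation ?D" unfolding opr_act by (intro derivation_act w)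
    note lin = lin_opD[OF derivationD(1)[OF D]]
    have shift: "opr (pCons 0 P) F = ?D (U F) - U (?D F)" if "F \<in> Func" for F
    proof
      fix a
      have "opr (pCons 0 P) F a = (\<Sum>i\<le>degree P. coeff P i * F (w (Suc i) * a))"
        unfolding opr_def FS.polysum_pCons
        by (simp add: polysum_def sum_fun_apply fscale_def)
      also have "\<dots> = (?D (U F) - U (?D F)) a"
        by (simp add: opr_act act_apply U w_Suc left_diff_distrib linear_diffD[OF FuncD[OF that]]
            right_diff_distrib sum_subtractf mult.assoc)
      finally show "opr (pCons 0 P) F a = (?D (U F) - U (?D F)) a" .
    qed
    have eig: "?D (U F) - U (?D F) = fscale \<mu> (?D F)" if "F \<in> Func" for F
    proof -
      have "opr (pCons 0 P) F = fscale \<mu> (?D F)"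
        using ann[OF that] unfolding opr_def
        by (simp only: FS.polysum_linear_factor FS.polysum_pCons FS.scale_zero_left add_0 right_minus_eq)
      then show ?thesis unfolding shift[OF that] .
    qed
    \<comment> \<open>The commutator of \<open>?D\<close> and \<open>U\<close> is \<mu> times
      \<open>?D\<close> and hence commutes with \<open>?D\<close>, so it vanishes by
      diagonalizability.\<close>
    have "?D (U F) = U (?D F)"
    proof (rule derivation_commutator[OF D _ _ F])
      show "lin_op U" unfolding U_def by (rule lin_op_act)
      fix F assume F: "F \<in> Func"
      show "?D (?D (U F) - U (?D F)) = ?D (U (?D F)) - U (?D (?D F))"
        by (simp only: eig[OF F] eig[OF lin(1)[OF F]] lin(2)[OF lin(1)[OF F]])
    qed
    then show ?thesis using shift[OF F] by simp
  qed
  \<comment> \<open>\<open>R\<close> holds the factors still to be treated; started with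
    \<open>P\<close> = 1, \<open>P\<close> collects the factors t that replace them.\<close>
  have ann: "\<exists>m. \<forall>F\<in>Func. opr (monom 1 m * P) F = 0"
    if "R \<noteq> 0" "\<And>F. F \<in> Func \<Longrightarrow> opr (R * P) F = 0" for R P
    using that
  proof (induction "degree R" arbitrary: R P rule: less_induct)
    case less
    show ?case
    proof (cases "degree R = 0")
      case True
      then obtain c where R: "R = [:c:]" by (rule degree_eq_zeroE)
      with less.prems(1) have c: "c \<noteq> 0" by simp
      have "opr P F = 0" if F: "F \<in> Func" for F
      proof -
        have "fscale c (opr P F) = 0"
          using less.prems(2)[OF F] unfolding R by (simp add: opr_def FS.polysum_smult)
        with c show ?thesis by (simp only: FS.scale_eq_0_iff simp_thms)
      qed
      then show ?thesis by (intro exI[of _ 0]) simp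
    next
      case False
      then obtain \<mu> where "poly R \<mu> = 0" using alg_closed_imp_poly_has_root[of R] by auto
      then obtain Q where R: "R = [:- \<mu>, 1:] * Q" unfolding poly_eq_0_iff_dvd by (auto elim: dvdE)
      then have Q: "Q \<noteq> 0" using less.prems by auto
      then have deg: "degree Q < degree R"
        unfolding R by (subst degree_mult_eq) auto
      have "opr (Q * pCons 0 P) F = 0" if F: "F \<in> Func" for F
      proof -
        have "opr (pCons 0 (Q * P)) F = 0"
          using less.prems(2) unfolding R mult.assoc by (intro step[of \<mu> "Q * P" F] F)
        then show ?thesis by simp
      qed
      then obtain m where "\<forall>F\<in>Func. opr (monom 1 m * pCons 0 P) F = 0"
        using less.hyps[OF deg Q] by blast
      then show ?thesis by (intro exI[of _ "Suc m"]) (simp add: monom_Suc)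
    qed
  qed
  have "w i \<in> span Basis" for i by (simp add: span_Basis)
  then obtain p where p: "p \<noteq> 0" "polysum scale p w = 0"
    using exists_annihilating_poly[OF finite_Basis] by blast
  let ?R = "map_poly \<iota> p"
  have deg: "degree ?R = degree p" by (simp add: degree_map_poly)
  have "?R \<noteq> 0" using p(1) by (simp add: map_poly_eq_0_iff)
  moreover have "opr (?R * 1) F = 0" if F: "F \<in> Func" for F
  proof
    fix a
    note linF = linear_sumD[OF FuncD[OF F]] linear_scaleD[OF FuncD[OF F]]
    have "opr (?R * 1) F a = F ((\<Sum>i\<le>degree p. scale (coeff p i) (w i)) * a)"
      by (simp add: opr_act act_apply deg coeff_map_poly linF sum_distrib_right scale_mult_left scale_ext_def)
    also have "\<dots> = 0" using p(2) linear_zeroD[OF FuncD[OF F]] by (simp add: polysum_def)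
    finally show "opr (?R * 1) F a = 0 a" by simp
  qed
  ultimately obtain m where m: "\<forall>F\<in>Func. opr (monom 1 m * 1) F = 0" using ann by blast
  have "w m = 0"
  proof (rule Func_separates)
    fix F assume F: "F \<in> Func"
    then have "opr (monom 1 m) F 1 = 0" using m by simp
    then have "F (w m) = 0" unfolding opr_def FS.polysum_monom by simp
    then show "F (w m) = F 0" by (simp add: linear_zeroD[OF FuncD[OF F]])
  qed
  \<comment> \<open>If ad y applied twice kills \<open>w i\<close>, then one application does. This
    lowers the index of a vanishing term down to \<open>w 1\<close> = [y,x].\<close>
  moreover have "w m = 0 \<Longrightarrow> w 1 = 0" for m
  proof (induction m)
    case 0
    then show ?case by (simp add: w_Suc)
  next
    case (Suc m)
    show ?case
    proof (cases m)
      case 0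
      then show ?thesis using Suc by simp
    next
      case (Suc i)
      have eq: "w i * y - y * w i = - w (Suc i)" by (simp add: w_Suc)
      have "y * w (Suc i) = w (Suc i) * y"
        using Suc.prems w_Suc[of "Suc i"] unfolding Suc by simp
      then have "w i * y = y * w i"
        by (intro ad_primitive_semisimple[OF y]) (simp only: eq mult_minus_left mult_minus_right)
      then have "w (Suc i) = 0" by (simp add: w_Suc)
      then show ?thesis using Suc.IH unfolding Suc by blast
    qed
  qed
  ultimately have "w 1 = 0" by blast
  then show ?thesis using w_Suc[of 0] by (simp add: w_def)
qed

text \<open>Along the filtration, [x,y] is primitive once x commutes with the previous term. As
  primitive elements commute, x commutes with [x,y], and diagonalizability gives [x,y] = 0.\<close>

lemma primitive_central:
  assumes x: "primitive x"
  shows "x * y = y * x"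
proof -
  obtain m where m: "filt m = UNIV" using filt_exhausts by blast
  have "\<forall>y\<in>filt n. x * y = y * x" for n
  proof (induction n)
    case 0
    then show ?case using filt_0_commute by metis
  next
    case (Suc n)
    show ?case
    proof
      fix y assume y: "y \<in> filt (Suc n)"
      have "primitive (x * y - y * x)"
        using filt_0_commute Suc.IH by (intro primitive_commutator[OF primitive_in_filt[OF x] y]) metis+
      then have "x * (x * y - y * x) = (x * y - y * x) * x" by (rule primitives_commute[OF x])
      then have "x * (y * x - x * y) = (y * x - x * y) * x" by (simp add: algebra_simps)
      then show "x * y = y * x" using ad_primitive_semisimple[OF x] by metis
    qed
  qed
  from this[of m] show ?thesis unfolding m by blast
qed

end

section \<open>Vanishing of the remaining commutators\<close>

locale integral_hopf = hopf_algebra scale \<Delta> \<epsilon> S + integral_bialgebra scale \<Delta> \<epsilon> Basis \<Lambda>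
  for scale :: "'k::field \<Rightarrow> 'h::ring_1 \<Rightarrow> 'h"
    and \<Delta> :: "'h \<Rightarrow> (('h \<times> 'h) \<Rightarrow>\<^sub>0 'k)"
    and \<epsilon> :: "'h \<Rightarrow> 'k"
    and S :: "'h \<Rightarrow> 'h"
    and Basis :: "'h set"
    and \<Lambda> :: 'h
begin

sublocale scalar_extension scale \<Delta> \<epsilon> Basis \<Lambda> "to_ac :: 'k \<Rightarrow> 'k alg_closure"
  by unfold_locales auto

text \<open>
  \<open>\<Sum> S(x\<^sub>1 \<Lambda>\<^sub>1) [y, x\<^sub>2] \<Lambda>\<^sub>2\<close> is evaluated in two ways: only the summand \<open>1 \<otimes> x\<close> of the comultiplication of
  \<open>x\<close> contributes, which gives \<open>[y, x]\<close>, while expanding the commutator gives zero.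
\<close>

lemma central_commutator_zero:
  assumes x: "x \<in> filt (Suc m)" and \<epsilon>x: "\<epsilon> x = 0"
    and comm: "\<And>b. b \<in> filt m \<Longrightarrow> y * b = b * y"
    and central: "\<And>a. (y * x - x * y) * a = a * (y * x - x * y)"
  shows "y * x = x * y"
proof -
  define z where "z = y * x - x * y"
  define \<beta> where "\<beta> a b = sw scale (\<lambda>c d. S (a * c) * ((y * b - b * y) * d)) \<Lambda>" for a b
  have bil: "bilinear scale scale \<beta>"
    unfolding \<beta>_def by (intro bilinearI linear_intros vector_space_axioms algebra_over_field_axioms)
  obtain q where q: "Poly_Mapping.keys q \<subseteq> filt m \<times> filt m"
    and swx: "\<And>(t :: 'k \<Rightarrow> 'h \<Rightarrow> 'h) \<beta>. vector_space t \<Longrightarrow> bilinear scale t \<beta>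
      \<Longrightarrow> sw t \<beta> x = \<beta> x 1 + \<beta> 1 x + lin_ext t (\<lambda>(a, b). \<beta> a b) q"
    using sw_filt[OF x] by blast
  have sw_zero: "sw scale (\<lambda>c d. 0) u = 0" for u
    by (simp add: sw_def case_prod_unfold lin_ext_fun_zero)
  have "\<beta> a b = 0" if "b \<in> filt m" for a b
    using comm[OF that] by (simp add: \<beta>_def sw_zero)
  then have "lin_ext scale (\<lambda>(a, b). \<beta> a b) q = 0"
    unfolding lin_ext_def using q by (intro sum.neutral) auto
  moreover have "\<beta> x 1 = 0"
    by (simp add: \<beta>_def sw_zero)
  ultimately have "sw scale \<beta> x = \<beta> 1 x"
    unfolding swx[OF vector_space_axioms bil] by simp
  also have "\<dots> = sw scale (\<lambda>c d. z * (S c * d)) \<Lambda>"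
  proof -
    have "S c * (z * d) = z * (S c * d)" for c d
      using central[of "S c"] unfolding z_def[symmetric] by (metis mult.assoc)
    then show ?thesis by (simp add: \<beta>_def z_def[symmetric])
  qed
  also have "\<dots> = z * sw scale (\<lambda>c d. S c * d) \<Lambda>"
    by (rule sw_linear_comm[symmetric]) (intro linear_intros vector_space_axioms algebra_over_field_axioms)
  also have "\<dots> = z"
    by (simp add: sw_antipode_left counit_integral)
  finally have z: "z = sw scale \<beta> x" ..
  \<comment> \<open>The part of the commutator with y in front is a Sweedler sum over
    \<open>x * \<Lambda>\<close>, which is \<epsilon>(x) \<Lambda> = 0. In the other part
    \<open>sw_antipode_mult\<close> produces the factor \<epsilon>(x) = 0.\<close>
  have "sw scale \<beta> x + sw scale (\<lambda>a b. sw scale (\<lambda>c d. S (a * c) * (b * (y * d))) \<Lambda>) x =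
      sw scale (\<lambda>a b. sw scale (\<lambda>c d. S (a * c) * (y * (b * d))) \<Lambda>) x"
    unfolding \<beta>_def by (subst sw_add_fun[symmetric], simp)+ (simp add: algebra_simps)
  also have "\<dots> = sw scale (\<lambda>a b. S a * (y * b)) (x * \<Lambda>)"
    by (rule sw_mult[symmetric]) (intro bilinearI linear_intros vector_space_axioms algebra_over_field_axioms)+
  also have "\<dots> = 0"
    unfolding integral \<epsilon>x by (simp add: linear_zeroD[OF linear_sw[OF vector_space_axioms bilinearI]] linear_intros)
  also have "sw scale (\<lambda>a b. sw scale (\<lambda>c d. S (a * c) * (b * (y * d))) \<Lambda>) x =
      sw scale (\<lambda>c d. sw scale (\<lambda>a b. S (a * c) * b * (y * d)) x) \<Lambda>"
    by (subst sw_swap[OF vector_space_axioms]) (simp add: mult.assoc)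
  also have "\<dots> = sw scale (\<lambda>c d. sw scale (\<lambda>a b. S (a * c) * b) x * (y * d)) \<Lambda>"
    by (simp add: sw_linear_comm[OF linear_mult_left[OF linear_self[OF vector_space_axioms]]])
  also have "\<dots> = 0"
    by (simp add: sw_antipode_mult \<epsilon>x sw_zero)
  finally show ?thesis using z by (simp add: z_def)
qed

text \<open>Subtracting \<epsilon>(x) 1 from x changes no commutator and makes the counit vanish;
  centrality of the commutator comes from its primitivity.\<close>

lemma commutator_zero:
  assumes x: "x \<in> filt (Suc m)" and comm: "\<And>b. b \<in> filt m \<Longrightarrow> y * b = b * y"
    and prim: "primitive (x * y - y * x)"
  shows "x * y = y * x"
proof -
  let ?x = "x - scale (\<epsilon> x) 1"
  have eq: "y * ?x - ?x * y = - (x * y - y * x)"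
    by (simp add: algebra_simps scale_mult_left scale_mult_right)
  have "y * ?x = ?x * y"
  proof (rule central_commutator_zero)
    show "?x \<in> filt (Suc m)"
      using x one_in_filt subspace_filt by (intro subspace_diff subspace_scale) auto
    show "\<epsilon> ?x = 0"
      by (simp add: linear_diffD[OF counit_linear] linear_scaleD[OF counit_linear] counit_one)
    show "(y * ?x - ?x * y) * a = a * (y * ?x - ?x * y)" for a
      unfolding eq mult_minus_left mult_minus_right primitive_central[OF prim, of a] ..
  qed (rule comm)
  with eq show ?thesis by simp
qed

lemma commutative:
  fixes x y :: 'h
  shows "x * y = y * x"
proof -
  \<comment> \<open>Merging the first two letters of a word of length n + 2 gives a word of length n
    + 1, because J is closed under products.\<close>
  have mono: "filt m \<subseteq> filt n" if "m \<le> n" for m n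
  proof -
    have "filt n \<subseteq> filt (Suc n)" for n
    proof
      fix x assume x: "x \<in> filt n"
      have "F x = 0" if "F \<in> aug_words (Suc (Suc n))" for F
      proof -
        from that obtain F1 F2 G where F: "F = convk F1 (convk F2 G)" "aug F1" "aug F2" "G \<in> aug_words n"
          by auto
        then have "F = convk (convk F1 F2) G" by (simp add: convk_assoc augD functional_aug_words)
        moreover have "aug (convk F1 F2)" using F by (simp add: aug_conv augD)
        ultimately have "F \<in> aug_words (Suc n)" using F(4) unfolding aug_words.simps by blast
        with x show ?thesis unfolding filt_def by blast
      qed
      then show "x \<in> filt (Suc n)" unfolding filt_def by blast
    qed
    then show ?thesis using that by (rule lift_Suc_mono_le)
  qed
  obtain m where m: "filt m = UNIV" using filt_exhausts by blast
  have "\<forall>x\<in>filt n. \<forall>y\<in>filt n. x * y = y * x" for n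
  proof (induction n)
    case 0
    then show ?case using filt_0_commute by metis
  next
    case (Suc n)
    \<comment> \<open>The inner induction on \<open>m\<close> supplies what
      \<open>primitive_commutator\<close> requires of \<open>y\<close>, namely that it commutes with
      the previous term \<open>filt m\<close>; the other commutations hold inside
      \<open>filt n\<close>.\<close>
    have step: "m \<le> n \<Longrightarrow> x \<in> filt m \<Longrightarrow> x * y = y * x" if y: "y \<in> filt (Suc n)" for x y m
    proof (induction m arbitrary: x)
      case 0
      then show ?case using filt_0_commute by metis
    next
      case (Suc m)
      have IH: "a * y = y * a" if "a \<in> filt m" for a
        using Suc that by simp
      have sub: "filt m \<subseteq> filt n" "filt (Suc m) \<subseteq> filt n" using Suc.prems(1) mono by simp_all
      show ?case
      proof (rule commutator_zero[OF Suc.prems(2)])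
        show "primitive (x * y - y * x)"
          using \<open>\<forall>x\<in>filt n. \<forall>y\<in>filt n. x * y = y * x\<close> sub Suc.prems(2) IH
          by (intro primitive_commutator[OF Suc.prems(2) y]) blast+
      qed (simp add: IH)
    qed
    show ?case
    proof (intro ballI)
      fix x y assume x: "x \<in> filt (Suc n)" and y: "y \<in> filt (Suc n)"
      have comm: "a * y = y * a" "a * x = x * a" if "a \<in> filt n" for a
        using step[OF y order.refl that] step[OF x order.refl that] by simp_all
      show "x * y = y * x"
      proof (rule commutator_zero[OF x])
        show "primitive (x * y - y * x)"
          using Suc.IH comm by (intro primitive_commutator[OF x y]) (blast, metis+)
      qed (simp add: comm)
    qed
  qed
  from this[of m] show ?thesis unfolding m by blast
qed

end

text \<open>The simple left ideals span H and \<epsilon>(1) = 1, so some simple I is not contained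
  in the kernel of \<epsilon>. By simplicity \<epsilon> is injective on I, and h \<Lambda> and
  \<epsilon>(h) \<Lambda> are elements of I with the same counit.\<close>

lemma (in bialgebra) semisimple_imp_integral:
  assumes semisimple
  obtains \<Lambda> where "\<And>h. h * \<Lambda> = scale (\<epsilon> h) \<Lambda>" "\<epsilon> \<Lambda> = 1"
proof -
  have ker: "subspace {x. \<epsilon> x = 0}"
    by (rule subspaceI)
       (simp_all add: linear_zeroD[OF counit_linear] linear_addD[OF counit_linear] linear_scaleD[OF counit_linear])
  have "\<exists>I x. simple_left_ideal I \<and> x \<in> I \<and> \<epsilon> x \<noteq> 0"
  proof (rule ccontr)
    assume "\<not> ?thesis"
    then have "span (\<Union>{I. simple_left_ideal I}) \<subseteq> {x. \<epsilon> x = 0}"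
      using ker by (intro span_minimal) auto
    then have "\<epsilon> 1 = 0" using assms by (auto simp: semisimple_def)
    then show False by (simp add: counit_one)
  qed
  then obtain I x where I: "simple_left_ideal I" and x: "x \<in> I" "\<epsilon> x \<noteq> 0" by blast
  have left: "left_ideal I" using I by (simp add: simple_left_ideal_def)
  let ?\<Lambda> = "scale (inverse (\<epsilon> x)) x"
  have "left_ideal (I \<inter> {x. \<epsilon> x = 0})"
    using left ker by (auto simp: left_ideal_def counit_mult intro: subspace_inter)
  moreover have "I \<inter> {x. \<epsilon> x = 0} \<noteq> I" using x by auto
  ultimately have zero: "I \<inter> {x. \<epsilon> x = 0} = {0}"
    using I unfolding simple_left_ideal_def by blast
  have \<Lambda>: "?\<Lambda> \<in> I" "\<epsilon> ?\<Lambda> = 1"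
    using left x(1) unfolding left_ideal_def
    by (blast intro: subspace_scale) (use x(2) in \<open>simp add: linear_scaleD[OF counit_linear]\<close>)
  have "h * ?\<Lambda> = scale (\<epsilon> h) ?\<Lambda>" for h
  proof -
    have "h * ?\<Lambda> - scale (\<epsilon> h) ?\<Lambda> \<in> I"
      using left \<Lambda>(1) unfolding left_ideal_def by (blast intro: subspace_diff subspace_scale)
    moreover have "\<epsilon> (h * ?\<Lambda> - scale (\<epsilon> h) ?\<Lambda>) = 0"
      using \<Lambda>(2) by (simp add: linear_diffD[OF counit_linear] linear_scaleD[OF counit_linear] counit_mult)
    ultimately have "h * ?\<Lambda> - scale (\<epsilon> h) ?\<Lambda> = 0" using zero by blast
    then show ?thesis by simp
  qed
  with \<Lambda>(2) show ?thesis by (rule that[rotated])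
qed

theorem corollary4p2:
  fixes p :: nat
    and scale :: "'k::field \<Rightarrow> 'h::ring_1 \<Rightarrow> 'h"
    and \<Delta> :: "'h \<Rightarrow> (('h \<times> 'h) \<Rightarrow>\<^sub>0 'k)"
    and \<epsilon> :: "'h \<Rightarrow> 'k"
    and S :: "'h \<Rightarrow> 'h"
  assumes "prime p"
    and "CHAR('k) = p"
    and "hopf_algebra scale \<Delta> \<epsilon> S"
    and "\<exists>B. finite_dimensional_vector_space scale B"
    and "coalgebra.connected scale \<Delta>"
    and "algebra_over_field.semisimple scale"
  shows "\<forall>x y :: 'h. x * y = y * x"
proof -
  interpret hopf_algebra scale \<Delta> \<epsilon> S by fact
  obtain B where "finite_dimensional_vector_space scale B" using assms(4) by blast
  then interpret finite_dimensional_vector_space scale B .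
  obtain \<Lambda> where \<Lambda>: "\<And>h. h * \<Lambda> = scale (\<epsilon> h) \<Lambda>" "\<epsilon> \<Lambda> = 1"
    using semisimple_imp_integral assms(6) by blast
  interpret integral_hopf scale \<Delta> \<epsilon> S B \<Lambda>
    using assms(5) \<Lambda> by unfold_locales auto
  show ?thesis using commutative by blast
qed

end
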